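(* Let $p\ge1$ be an integer and let $n\in\mathbf N_0$ have one of the properties $(j_p)$, $j\in\{1,2,3\}$, with $D_p=\det(s_{i+l})_{i,l=0}^{p}\ne0$. Let $\sigma$ be the finite positive measure on $\mathbb R$ with $n(z)=\int_{\mathbb R}\frac{d\sigma(t)}{t-z}$, let $A$ be multiplication by the independent variable in $\mathcal H=L^2(\sigma)$, and $u(t)\equiv1$. Let $e_k,d_k$, $k=0,\dots,p$, be the polynomials of the first and second kind associated with $n$ and let $b_{p-1}=(Ae_{p-1},e_p)>0$. Let $D$ be the compression of $A$ to $\mathcal H_p'=\mathcal H\ominus\operatorname{span}\{1,t,\dots,t^{p-1}\}$, $u_p=b_{p-1}e_p\in\mathcal H_p'$, and $$n_p(z)=\big((D-z)^{-1}u_p,u_p\big),\qquad z\in\mathbb C\setminus\mathbb R.$$ Then $$n(z)=\big((A-z)^{-1}u,u\big)=-\frac{d_{p-1}(z)\,n_p(z)+b_{p-1}d_p(z)}{e_{p-1}(z)\,n_p(z)+b_{p-1}e_p(z)},\qquad z\in\mathbb C\setminus\mathbb R.$$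
   Context: A Nevanlinna function is a function $n$ that is analytic in the open upper half plane $\mathbb C^+$ with $\operatorname{Im} n(z)\ge 0$ for $z\in\mathbb C^+$; it is always extended to the lower half plane by $n(z)=n(z^* )^*$, where $z^*$ denotes the complex conjugate. $\mathbf N_0$ denotes the set of all Nevanlinna functions. For an integer $p\ge 1$ the properties mean that there are real numbers $s_0,s_1,\dots$ such that, for $z=iy$, $y\to\pm\infty$: $(1_p)$: $n(z)=-\frac{s_0}{z}-\frac{s_1}{z^2}-\cdots-\frac{s_{2p}}{z^{2p+1}}+\mathrm o\!\left(\frac1{z^{2p+1}}\right)$; $(2_p)$: $n(z)=-\frac{s_0}{z}-\cdots-\frac{s_{2p}}{z^{2p+1}}+\mathrm O\!\left(\frac1{z^{2p+2}}\right)$; $(3_p)$: $n(z)=-\frac{s_0}{z}-\cdots-\frac{s_{2p+1}}{z^{2p+2}}+\mathrm o\!\left(\frac1{z^{2p+2}}\right)$. Clearly $(3_p)\Rightarrow(2_p)\Rightarrow(1_p)$, and $(1_p)$ implies that $n(z)=\int_{\mathbb R}\frac{d\sigma(t)}{t-z}$ with a unique finite positive Borel measure $\sigma$, with $s_i=\int t^i\,d\sigma(t)$ for $0\le i\le2p$. The polynomials of the first kind $e_0,\dots,e_p$ are obtained by Gram–Schmidt orthonormalization of $1,t,\dots,t^p$ in $L^2(\sigma)$: $e_k$ is a real polynomial of degree $k$ with positive leading coefficient and $\int e_ie_k\,d\sigma=\delta_{ik}$. They satisfy $te_k=b_{k-1}e_{k-1}+a_ke_k+b_ke_{k+1}$,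 $0\le k\le p-1$, with $b_{-1}=0$, $a_k\in\mathbb R$, $b_k>0$. The polynomials of the second kind are $d_k(z)=\int_{\mathbb R}\frac{e_k(z)-e_k(t)}{z-t}\,d\sigma(t)$, $k=0,\dots,p$. The compression of $A$ to a closed subspace $\mathcal K$ is $P_{\mathcal K}A|_{\mathcal K}$ with domain $\operatorname{dom}A\cap\mathcal K$, $P_{\mathcal K}$ being the orthogonal projection onto $\mathcal K$; the compression $D$ is self-adjoint in $\mathcal H_p'$. *)

theory Defs
  imports
    "HOL-Analysis.Analysis"
    "HOL-Library.Landau_Symbols"
    "HOL-Computational_Algebra.Polynomial"
    "Jordan_Normal_Form.Determinant"
begin

text \<open>Only the values off the real axis matter; on the real axis \<open>n\<close> is an arbitrary HOL value.\<close>

definition nevanlinna :: "(complex \<Rightarrow> complex) \<Rightarrow> bool" where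
  "nevanlinna n \<longleftrightarrow>
     n analytic_on {z. Im z > 0} \<and>
     (\<forall>z. Im z > 0 \<longrightarrow> Im (n z) \<ge> 0) \<and>
     (\<forall>z. Im z < 0 \<longrightarrow> n z = cnj (n (cnj z)))"

text \<open>The remainder \<open>n(z) + s\<^sub>0/z + \<dots> + s\<^sub>m/z\<^bsup>m+1\<^esup>\<close> at \<open>z = iy\<close>. In the three properties below,
  \<open>at_infinity\<close> on the reals covers both \<open>y \<rightarrow> +\<infinity>\<close> and \<open>y \<rightarrow> -\<infinity>\<close>.\<close>

definition expansion_remainder :: "(complex \<Rightarrow> complex) \<Rightarrow> (nat \<Rightarrow> real) \<Rightarrow> nat \<Rightarrow> real \<Rightarrow> complex" where
  "expansion_remainder n s m y =
     (let z = \<i> * complex_of_real y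
      in n z - (\<Sum>i\<le>m. - complex_of_real (s i) / z ^ (i + 1)))"

definition property1 :: "nat \<Rightarrow> (complex \<Rightarrow> complex) \<Rightarrow> (nat \<Rightarrow> real) \<Rightarrow> bool" where
  "property1 p n s \<longleftrightarrow> expansion_remainder n s (2 * p)
     \<in> o[at_infinity](\<lambda>y. 1 / (\<i> * complex_of_real y) ^ (2 * p + 1))"

definition property2 :: "nat \<Rightarrow> (complex \<Rightarrow> complex) \<Rightarrow> (nat \<Rightarrow> real) \<Rightarrow> bool" where
  "property2 p n s \<longleftrightarrow> expansion_remainder n s (2 * p)
     \<in> O[at_infinity](\<lambda>y. 1 / (\<i> * complex_of_real y) ^ (2 * p + 2))"

definition property3 :: "nat \<Rightarrow> (complex \<Rightarrow> complex) \<Rightarrow> (nat \<Rightarrow> real) \<Rightarrow> bool" where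
  "property3 p n s \<longleftrightarrow> expansion_remainder n s (2 * p + 1)
     \<in> o[at_infinity](\<lambda>y. 1 / (\<i> * complex_of_real y) ^ (2 * p + 2))"

text \<open>The names \<open>det\<close> and \<open>mat\<close> also exist in \<open>HOL-Analysis\<close> (for type-indexed matrices),
  hence the qualification.\<close>

definition hankel_det :: "nat \<Rightarrow> (nat \<Rightarrow> real) \<Rightarrow> real" where
  "hankel_det p s = Determinant.det (Matrix.mat (p + 1) (p + 1) (\<lambda>(i, l). s (i + l)))"

text \<open>Elements of \<open>L\<^sup>2(M)\<close> are represented by square integrable functions; two functions represent
  the same element iff they agree almost everywhere. The inner product is linear in the first
  argument.\<close>

type_synonym l2_vec = "real \<Rightarrow> complex"

definition L2 :: "real measure \<Rightarrow> l2_vec set" where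
  "L2 M = {f. f \<in> borel_measurable M \<and> integrable M (\<lambda>t. (cmod (f t))\<^sup>2)}"

definition L2_inner :: "real measure \<Rightarrow> l2_vec \<Rightarrow> l2_vec \<Rightarrow> complex" where
  "L2_inner M f g = (\<integral>t. f t * cnj (g t) \<partial>M)"

definition L2_ominus :: "real measure \<Rightarrow> l2_vec set \<Rightarrow> l2_vec set" where
  "L2_ominus M S = {f \<in> L2 M. \<forall>g\<in>S. L2_inner M f g = 0}"

definition monomial_span :: "nat \<Rightarrow> l2_vec set" where
  "monomial_span p = {\<lambda>t. \<Sum>j<p. c j * complex_of_real t ^ j | c. True}"

text \<open>\<open>L2_proj M K f\<close> is a representative of the orthogonal projection of \<open>f\<close> onto \<open>K\<close>,
  which is determined only almost everywhere.\<close>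

definition L2_proj :: "real measure \<Rightarrow> l2_vec set \<Rightarrow> l2_vec \<Rightarrow> l2_vec" where
  "L2_proj M K f = (SOME g. g \<in> K \<and> (\<forall>h\<in>K. L2_inner M (\<lambda>t. f t - g t) h = 0))"

text \<open>An unbounded operator is a pair consisting of its domain and its action; the values of the
  action outside the domain are irrelevant.\<close>

type_synonym l2_op = "l2_vec set \<times> (l2_vec \<Rightarrow> l2_vec)"

definition mult_op :: "real measure \<Rightarrow> l2_op" where
  "mult_op M =
     ({f \<in> L2 M. (\<lambda>t. complex_of_real t * f t) \<in> L2 M}, \<lambda>f t. complex_of_real t * f t)"

definition compression :: "real measure \<Rightarrow> l2_vec set \<Rightarrow> l2_op \<Rightarrow> l2_op" where
  "compression M K T = (fst T \<inter> K, \<lambda>f. L2_proj M K (snd T f))"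

text \<open>\<open>resolvent M T z v\<close> is a representative of \<open>(T - z)\<^sup>-\<^sup>1 v\<close>, that is, a solution \<open>x\<close> in the
  domain of \<open>T\<close> of \<open>T x - z x = v\<close> (as elements of \<open>L\<^sup>2(M)\<close>).\<close>

definition resolvent :: "real measure \<Rightarrow> l2_op \<Rightarrow> complex \<Rightarrow> l2_vec \<Rightarrow> l2_vec" where
  "resolvent M T z v = (SOME x. x \<in> fst T \<and> (AE t in M. snd T x t - z * x t = v t))"

definition cpoly :: "real poly \<Rightarrow> complex \<Rightarrow> complex" where
  "cpoly q z = poly (map_poly complex_of_real q) z"

definition poly_vec :: "real poly \<Rightarrow> l2_vec" where
  "poly_vec q = (\<lambda>t. complex_of_real (poly q t))"

text \<open>Gram--Schmidt orthonormalization of \<open>1, t, t\<^sup>2, \<dots>\<close> in \<open>L\<^sup>2(M)\<close>; meaningful for those \<open>k\<close> for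
  which \<open>1, \<dots>, t\<^sup>k\<close> are linearly independent elements of \<open>L\<^sup>2(M)\<close>.\<close>

function first_kind :: "real measure \<Rightarrow> nat \<Rightarrow> real poly" where
  "first_kind M k =
     (let q = Polynomial.monom 1 k
              - (\<Sum>j\<leftarrow>[0..<k]. Polynomial.smult (\<integral>t. t ^ k * poly (first_kind M j) t \<partial>M) (first_kind M j))
      in Polynomial.smult (1 / sqrt (\<integral>t. (poly q t)\<^sup>2 \<partial>M)) q)"
  by pat_completeness auto
termination by (relation "Wellfounded.measure snd") auto

declare first_kind.simps [simp del]

text \<open>The formula represents the polynomial \<open>d\<^sub>k\<close> at nonreal \<open>z\<close>; at a real \<open>z\<close> that is an atom of
  \<open>M\<close> it is off, since the integrand is \<open>0\<close> at \<open>t = z\<close>.\<close>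

definition second_kind :: "real measure \<Rightarrow> nat \<Rightarrow> complex \<Rightarrow> complex" where
  "second_kind M k z =
     (\<integral>t. (cpoly (first_kind M k) z - cpoly (first_kind M k) (complex_of_real t))
           / (z - complex_of_real t) \<partial>M)"

end

theory Submission
  imports Defs
begin

text \<open>
  The asymptotic expansion forces the moments of \<open>\<sigma>\<close> up to order \<open>2p\<close> to be finite and equal to the
  \<open>s\<^sub>i\<close>, so the Hankel condition makes \<open>1, t, \<dots>, t\<^sup>p\<close> linearly independent in \<open>L\<^sup>2(\<sigma>)\<close>.

  For nonreal \<open>z\<close> let \<open>w\<^sub>k = \<integral> e\<^sub>k(t) / (t - z) d\<sigma>(t) = e\<^sub>k(z) n(z) + d\<^sub>k(z)\<close>. The projection \<open>v\<close> of
  \<open>1 / (t - z)\<close> onto \<open>H'\<close> is \<open>1 / (t - z) - (\<Sum>j<p. w\<^sub>j e\<^sub>j)\<close>, and \<open>(t - z) v\<close> is the polynomial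
  \<open>b (w\<^sub>p e\<^bsub>p-1\<^esub> - w\<^bsub>p-1\<^esub> e\<^sub>p)\<close>. Its value at \<open>t = z\<close> is \<open>1\<close>, which is a Wronskian identity, and
  \<open>- v / w\<^bsub>p-1\<^esub>\<close> represents \<open>(D - z)\<^sup>-\<^sup>1 u\<^sub>p\<close>. Hence \<open>n\<^sub>p = - b w\<^sub>p / w\<^bsub>p-1\<^esub>\<close>; solving this for \<open>n\<close> gives
  the formula, and by the Wronskian identity its denominator is \<open>- 1 / w\<^bsub>p-1\<^esub>\<close>.
\<close>

section \<open>Moments from the asymptotic expansion\<close>

text \<open>Only the positive half of the imaginary axis is kept, since the moments are already
  determined there. The power of \<open>z\<close> turns the little-o condition into a plain
  limit.\<close>

definition truncated_expansion :: "(complex \<Rightarrow> complex) \<Rightarrow> (nat \<Rightarrow> real) \<Rightarrow> nat \<Rightarrow> bool" where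
  "truncated_expansion n s m \<longleftrightarrow>
     ((\<lambda>y. (\<i> * complex_of_real y) ^ (m + 1) * expansion_remainder n s m y) \<longlongrightarrow> 0) at_top"

lemma inverse_imaginary_tendsto_0: "((\<lambda>y. 1 / (\<i> * complex_of_real y)) \<longlongrightarrow> 0) at_top"
proof -
  have "((\<lambda>y. complex_of_real (inverse y)) \<longlongrightarrow> complex_of_real 0) at_top"
    by (intro tendsto_of_real tendsto_mono[OF at_top_le_at_infinity tendsto_inverse_0])
  then have "((\<lambda>y. - \<i> * complex_of_real (inverse y)) \<longlongrightarrow> - \<i> * complex_of_real 0) at_top"
    by (rule tendsto_mult_left)
  moreover have "- \<i> * complex_of_real (inverse y) = 1 / (\<i> * complex_of_real y)" for y
    by (simp add: divide_inverse)
  ultimately show ?thesis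
    by (simp only: of_real_0 mult_zero_right)
qed

text \<open>Omitting the last term \<open>s (Suc m) / z ^ (m + 2)\<close> changes
  \<open>z ^ (m + 1)\<close> times the remainder by a multiple of \<open>1 / z\<close>, and the
  longer remainder gains a factor \<open>1 / z\<close> as well.\<close>

lemma truncated_expansion_SucD:
  assumes "truncated_expansion n s (Suc m)"
  shows "truncated_expansion n s m"
proof -
  let ?z = "\<lambda>y. \<i> * complex_of_real y"
  have "((\<lambda>y. (1 / ?z y) * (?z y ^ (Suc m + 1) * expansion_remainder n s (Suc m) y)
            - of_real (s (Suc m)) * (1 / ?z y)) \<longlongrightarrow> 0 * 0 - of_real (s (Suc m)) * 0) at_top"
    using assms unfolding truncated_expansion_def
    by (intro tendsto_intros inverse_imaginary_tendsto_0)
  moreover have "\<forall>\<^sub>F y in at_top. (1 / ?z y) * (?z y ^ (Suc m + 1) * expansion_remainder n s (Suc m) y)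
      - of_real (s (Suc m)) * (1 / ?z y) = ?z y ^ (m + 1) * expansion_remainder n s m y"
    using eventually_gt_at_top[of 0]
  proof eventually_elim
    case (elim y)
    define z where "z = ?z y"
    have "z \<noteq> 0"
      using elim by (simp add: z_def)
    then have "(1 / z) * (z ^ (Suc m + 1) * expansion_remainder n s (Suc m) y) - of_real (s (Suc m)) * (1 / z)
      = z ^ (m + 1) * expansion_remainder n s m y"
      unfolding expansion_remainder_def Let_def z_def[symmetric]
      by (simp add: field_simps)
    then show ?case
      by (simp add: z_def)
  qed
  ultimately show ?thesis
    unfolding truncated_expansion_def by (simp add: tendsto_cong)
qed

lemma truncated_expansion_mono:
  assumes "truncated_expansion n s m" "k \<le> m"
  shows "truncated_expansion n s k"
  using assms(2,1) by (induction rule: inc_induct) (auto intro: truncated_expansion_SucD)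

lemma smallo_imp_truncated_expansion:
  assumes "expansion_remainder n s m \<in> o[at_infinity](\<lambda>y. 1 / (\<i> * complex_of_real y) ^ (m + 1))"
  shows "truncated_expansion n s m"
proof -
  have "((\<lambda>y. expansion_remainder n s m y / (1 / (\<i> * complex_of_real y) ^ (m + 1))) \<longlongrightarrow> 0) at_infinity"
    using assms by (rule smalloD_tendsto)
  then have "((\<lambda>y. (\<i> * complex_of_real y) ^ (m + 1) * expansion_remainder n s m y) \<longlongrightarrow> 0) at_infinity"
    by (simp add: mult.commute)
  then show ?thesis
    unfolding truncated_expansion_def by (rule tendsto_mono[OF at_top_le_at_infinity])
qed

text \<open>All three cases reduce to the weakest one: the big-O bound of \<open>property2\<close>
  is one power of \<open>z\<close> better than the required little-o, and \<open>property3\<close>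
  has one extra term, which is dropped.\<close>

lemma property_imp_truncated_expansion:
  assumes "property1 p n s \<or> property2 p n s \<or> property3 p n s"
  shows "truncated_expansion n s (2 * p)"
proof -
  have 2: "property1 p n s" if "property2 p n s"
  proof -
    have "(\<lambda>y. 1 / (\<i> * complex_of_real y) ^ (2 * p + 2))
        \<in> o[at_infinity](\<lambda>y. 1 / (\<i> * complex_of_real y) ^ (2 * p + 1))"
    proof (rule smalloI_tendsto)
      have "((\<lambda>y::real. - \<i> * of_real (inverse y)) \<longlongrightarrow> - \<i> * of_real 0) at_infinity"
        by (intro tendsto_intros tendsto_of_real tendsto_inverse_0)
      then have "((\<lambda>y::real. - \<i> * of_real (inverse y)) \<longlongrightarrow> 0) at_infinity"
        by (simp only: of_real_0 mult_zero_right)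
      then show "((\<lambda>y. 1 / (\<i> * complex_of_real y) ^ (2 * p + 2) / (1 / (\<i> * complex_of_real y) ^ (2 * p + 1)))
          \<longlongrightarrow> 0) at_infinity"
      proof (rule Lim_transform_eventually)
        show "\<forall>\<^sub>F y in at_infinity. - \<i> * complex_of_real (inverse y) =
            1 / (\<i> * complex_of_real y) ^ (2 * p + 2) / (1 / (\<i> * complex_of_real y) ^ (2 * p + 1))"
          using eventually_not_equal_at_infinity[of 0]
          by eventually_elim (simp add: field_simps)
      qed
      show "\<forall>\<^sub>F y in at_infinity. 1 / (\<i> * complex_of_real y) ^ (2 * p + 1) \<noteq> 0"
        using eventually_not_equal_at_infinity[of 0] by eventually_elim simp
    qed
    then show ?thesis
      using that unfolding property1_def property2_def by (meson landau_o.big_small_trans)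
  qed
  show ?thesis
    using assms
  proof (elim disjE)
    assume "property3 p n s"
    then have "truncated_expansion n s (2 * p + 1)"
      unfolding property3_def by (intro smallo_imp_truncated_expansion) (simp add: numeral_2_eq_2)
    then show ?thesis
      by (rule truncated_expansion_mono) simp
  qed (use 2 in \<open>auto simp: property1_def intro: smallo_imp_truncated_expansion\<close>)
qed

text \<open>The geometric series of the Cauchy kernel at infinity with its exact remainder.
  Integrated over \<open>t\<close>, the sum cancels the terms of the expansion whose moments are
  already known.\<close>

lemma cauchy_kernel_expansion:
  fixes t z :: complex
  assumes "z \<noteq> 0" "t \<noteq> z"
  shows "1 / (t - z) + (\<Sum>i<m. t ^ i / z ^ (i + 1)) = t ^ m / (z ^ m * (t - z))"
proof (induction m)
  case (Suc m)
  have "1 / (t - z) + (\<Sum>i<Suc m. t ^ i / z ^ (i + 1)) = t ^ m / (z ^ m * (t - z)) + t ^ m / z ^ (m + 1)"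
    by (simp add: Suc.IH[symmetric] add.assoc del: Suc.IH)
  also have "\<dots> = t ^ Suc m / (z ^ Suc m * (t - z))"
    using assms by (simp add: divide_simps) (simp add: algebra_simps)
  finally show ?case .
qed simp

lemma abs_power_le_one_plus_even_power:
  fixes t :: real
  assumes "j \<le> 2 * k"
  shows "\<bar>t ^ j\<bar> \<le> 1 + t ^ (2 * k)"
proof (cases "\<bar>t\<bar> \<le> 1")
  case True
  then have "\<bar>t ^ j\<bar> \<le> 1"
    by (simp add: power_abs power_le_one)
  moreover have "0 \<le> t ^ (2 * k)"
    by simp
  ultimately show ?thesis
    by linarith
next
  case False
  then have "\<bar>t\<bar> ^ j \<le> \<bar>t\<bar> ^ (2 * k)"
    using assms by (intro power_increasing) auto
  then show ?thesis
    by (simp add: power_abs power_even_abs)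
qed

lemma integrable_power:
  fixes M :: "real measure"
  assumes "finite_measure M" and [measurable_cong]: "sets M = sets borel"
    and "integrable M (\<lambda>t. t ^ (2 * k))" "j \<le> 2 * k"
  shows "integrable M (\<lambda>t. t ^ j)"
proof (rule Bochner_Integration.integrable_bound)
  interpret finite_measure M by fact
  show "integrable M (\<lambda>t. 1 + t ^ (2 * k))"
    using assms(3) by simp
  show "AE t in M. norm (t ^ j) \<le> norm (1 + t ^ (2 * k))"
    using abs_power_le_one_plus_even_power[OF assms(4)]
    by (intro AE_I2) (metis abs_ge_self order_trans real_norm_def)
qed measurable

text \<open>The real and imaginary parts of the remainder at \<open>z = iy\<close> are, up to powers of \<open>y\<close>,
  the regularized moments \<open>\<integral> t\<^sup>j y\<^sup>2 / (t\<^sup>2 + y\<^sup>2)\<close>; monotone convergence applies to the even one and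
  dominated convergence to the odd one.\<close>

lemma next_moments:
  fixes M :: "real measure"
  assumes fin: "finite_measure M" and [measurable_cong]: "sets M = sets borel"
    and n: "\<And>z. z \<notin> \<real> \<Longrightarrow> n z = (\<integral>t. 1 / (complex_of_real t - z) \<partial>M)"
    and exp: "truncated_expansion n s (2 * k + 2)"
    and int: "integrable M (\<lambda>t. t ^ (2 * k))"
    and mom: "\<And>i. i \<le> 2 * k \<Longrightarrow> s i = (\<integral>t. t ^ i \<partial>M)"
  shows "integrable M (\<lambda>t. t ^ (2 * k + 2))"
    and "s (2 * k + 2) = (\<integral>t. t ^ (2 * k + 2) \<partial>M)"
    and "s (2 * k + 1) = (\<integral>t. t ^ (2 * k + 1) \<partial>M)"
proof -
  interpret finite_measure M by fact
  define reg where "reg j y t = t ^ j * (y\<^sup>2 / (t\<^sup>2 + y\<^sup>2))" for j and y t :: real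
  have reg_meas [measurable]: "reg j y \<in> borel_measurable M" for j y
    unfolding reg_def by measurable
  \<comment> \<open>For fixed \<open>y\<close> the factor
    \<open>y\<^sup>2 / (t\<^sup>2 + y\<^sup>2)\<close> absorbs up to two powers of \<open>t\<close>:
    one at the cost \<open>y\<close>, two at the cost \<open>y\<^sup>2\<close>. Hence the moment of
    order \<open>2 * k\<close> dominates.\<close>
  have int_reg: "integrable M (reg j y)" if "y > 0" "j = 2 * k + 1 \<or> j = 2 * k + 2" for j y
  proof (rule Bochner_Integration.integrable_bound)
    show "integrable M (\<lambda>t. (y + y\<^sup>2) * t ^ (2 * k))"
      using int by simp
    have "norm (reg j y t) \<le> norm ((y + y\<^sup>2) * t ^ (2 * k))" for t
    proof -
      have pos: "t\<^sup>2 + y\<^sup>2 > 0"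
        using that by (simp add: add_nonneg_pos)
      have "2 * (\<bar>t\<bar> * y) \<le> t\<^sup>2 + y\<^sup>2"
        using sum_squares_bound[of "\<bar>t\<bar>" y] by simp
      moreover have "0 \<le> \<bar>t\<bar> * y"
        using that by simp
      ultimately have "\<bar>t\<bar> * y \<le> t\<^sup>2 + y\<^sup>2"
        by linarith
      then have "\<bar>t\<bar> * y\<^sup>2 \<le> y * (t\<^sup>2 + y\<^sup>2)"
        using that by (simp add: power2_eq_square)
      then have 1: "\<bar>t\<bar> * (y\<^sup>2 / (t\<^sup>2 + y\<^sup>2)) \<le> y"
        using pos by (simp add: field_simps)
      have 2: "t\<^sup>2 * (y\<^sup>2 / (t\<^sup>2 + y\<^sup>2)) \<le> y\<^sup>2"
        using pos by (simp add: field_simps)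
      show ?thesis
        using that(2)
      proof
        assume j: "j = 2 * k + 1"
        have "norm (reg j y t) = t ^ (2 * k) * (\<bar>t\<bar> * (y\<^sup>2 / (t\<^sup>2 + y\<^sup>2)))"
          using pos by (simp add: reg_def j abs_mult power_abs power_even_abs)
        also have "\<dots> \<le> t ^ (2 * k) * (y + y\<^sup>2)"
          using 1 by (intro mult_left_mono) (auto intro: order_trans)
        finally show ?thesis
          using that by (simp add: mult.commute)
      next
        assume j: "j = 2 * k + 2"
        have "norm (reg j y t) = t ^ (2 * k) * (t\<^sup>2 * (y\<^sup>2 / (t\<^sup>2 + y\<^sup>2)))"
          using pos by (simp add: reg_def j abs_mult power_abs power_even_abs power_add power2_eq_square)
        also have "\<dots> \<le> t ^ (2 * k) * (y + y\<^sup>2)"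
          using 2 that by (intro mult_left_mono) auto
        finally show ?thesis
          using that by (simp add: mult.commute)
      qed
    qed
    then show "AE t in M. norm (reg j y t) \<le> norm ((y + y\<^sup>2) * t ^ (2 * k))"
      by simp
  qed measurable
  define T where "T y = (\<i> * complex_of_real y) ^ (2 * k + 3) * expansion_remainder n s (2 * k + 2) y" for y
  \<comment> \<open>After the known moments cancel, the integrand is
    \<open>z\<^sup>2 * t ^ (2 * k + 1) / (t - z)\<close>. Since
    \<open>z\<^sup>2 = - y\<^sup>2\<close> and
    \<open>1 / (t - z) = (t + z) / (t\<^sup>2 + y\<^sup>2)\<close>, its real part is the even
    regularized moment and its imaginary part \<open>y\<close> times the odd one, both
    negated.\<close>
  have T_eq: "T y = Complex (s (2 * k + 2) - (\<integral>t. reg (2 * k + 2) y t \<partial>M))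
      (y * (s (2 * k + 1) - (\<integral>t. reg (2 * k + 1) y t \<partial>M)))" if y: "y > 0" for y
  proof -
    define z where "z = \<i> * complex_of_real y"
    have z: "z \<noteq> 0" "z \<notin> \<real>" and z2: "z\<^sup>2 = - (complex_of_real y)\<^sup>2"
      using y by (auto simp: z_def complex_is_Real_iff power_mult_distrib)
    have tz: "complex_of_real t \<noteq> z" for t
      using z(2) by auto
    have int_pow: "integrable M (\<lambda>t. complex_of_real t ^ i)" if "i \<le> 2 * k" for i
      using integrable_of_real[OF integrable_power[OF fin assms(2) int that], where ?'a = complex] by simp
    have "z ^ (2 * k + 3) * (n z + (\<Sum>i<2*k+1. complex_of_real (s i) / z ^ (i + 1)))
      = z ^ (2 * k + 3) * (\<integral>t. 1 / (complex_of_real t - z) + (\<Sum>i<2*k+1. complex_of_real t ^ i / z ^ (i + 1)) \<partial>M)"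
    proof -
      have "complex_of_real (s i) / z ^ (i + 1) = (\<integral>t. complex_of_real t ^ i / z ^ (i + 1) \<partial>M)"
        if "i \<in> {..<2*k+1}" for i
      proof -
        have "complex_of_real (s i) = (\<integral>t. complex_of_real t ^ i \<partial>M)"
          using mom[of i] that by (simp flip: of_real_power)
        then show ?thesis
          using int_pow[of i] that by simp
      qed
      then have "(\<Sum>i<2*k+1. complex_of_real (s i) / z ^ (i + 1))
          = (\<Sum>i<2*k+1. (\<integral>t. complex_of_real t ^ i / z ^ (i + 1) \<partial>M))"
        by (rule sum.cong[OF refl])
      also have "\<dots> = (\<integral>t. (\<Sum>i<2*k+1. complex_of_real t ^ i / z ^ (i + 1)) \<partial>M)"
        using int_pow by (subst Bochner_Integration.integral_sum) auto
      finally have sum: "(\<Sum>i<2*k+1. complex_of_real (s i) / z ^ (i + 1)) =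
        (\<integral>t. (\<Sum>i<2*k+1. complex_of_real t ^ i / z ^ (i + 1)) \<partial>M)" .
      have "integrable M (\<lambda>t. \<Sum>i<2*k+1. complex_of_real t ^ i / z ^ (i + 1))"
        using int_pow by (intro Bochner_Integration.integrable_sum integrable_divide) auto
      moreover have "integrable M (\<lambda>t. 1 / (complex_of_real t - z))"
      proof (rule integrable_const_bound[where B = "1 / y"])
        have "norm (1 / (complex_of_real t - z)) \<le> 1 / y" for t
          using abs_Im_le_cmod[of "complex_of_real t - z"] y
          by (auto simp: z_def norm_divide intro!: divide_left_mono mult_pos_pos)
        then show "AE t in M. norm (1 / (complex_of_real t - z)) \<le> 1 / y"
          by simp
      qed measurable
      ultimately show ?thesis
        unfolding n[OF z(2)] sum by (simp only: Bochner_Integration.integral_add)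
    qed
    also have "\<dots> = (\<integral>t. z ^ (2 * k + 3) * (1 / (complex_of_real t - z) + (\<Sum>i<2*k+1. complex_of_real t ^ i / z ^ (i + 1))) \<partial>M)"
      by simp
    also have "\<dots> = (\<integral>t. complex_of_real (- reg (2 * k + 2) y t) - \<i> * y * complex_of_real (reg (2 * k + 1) y t) \<partial>M)"
    proof (rule Bochner_Integration.integral_cong[OF refl])
      fix t
      let ?t = "complex_of_real t"
      have "t\<^sup>2 + y\<^sup>2 \<noteq> 0"
        using y by (simp add: sum_power2_eq_zero_iff)
      then have ty: "?t\<^sup>2 + (complex_of_real y)\<^sup>2 \<noteq> 0"
        by (metis of_real_add of_real_eq_0_iff of_real_power)
      have "(?t - z) * (?t + z) = ?t\<^sup>2 + (complex_of_real y)\<^sup>2"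
        using z2 by (simp add: power2_eq_square algebra_simps)
      then have inv: "1 / (?t - z) = (?t + z) / (?t\<^sup>2 + (complex_of_real y)\<^sup>2)"
        using tz[of t] ty by (simp add: field_simps)
      have "z ^ (2 * k + 3) * (1 / (?t - z) + (\<Sum>i<2*k+1. ?t ^ i / z ^ (i + 1)))
         = z ^ (2 * k + 3) * (?t ^ (2*k+1) / (z ^ (2*k+1) * (?t - z)))"
        by (simp only: cauchy_kernel_expansion[OF z(1) tz])
      also have "\<dots> = z\<^sup>2 * ?t ^ (2 * k + 1) * (1 / (?t - z))"
        using z tz[of t] by (simp add: field_simps power_add power2_eq_square power3_eq_cube)
      also have "\<dots> = complex_of_real (- reg (2 * k + 2) y t) - \<i> * y * complex_of_real (reg (2 * k + 1) y t)"
        unfolding inv z2 reg_def using ty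
        by (simp add: z_def divide_simps) (simp add: algebra_simps power_add power2_eq_square)
      finally show "z ^ (2 * k + 3) * (1 / (?t - z) + (\<Sum>i<2*k+1. ?t ^ i / z ^ (i + 1))) =
        complex_of_real (- reg (2 * k + 2) y t) - \<i> * y * complex_of_real (reg (2 * k + 1) y t)" .
    qed
    also have "\<dots> = of_real (- (\<integral>t. reg (2 * k + 2) y t \<partial>M)) - \<i> * y * of_real (\<integral>t. reg (2 * k + 1) y t \<partial>M)"
      using int_reg[OF y] by (subst Bochner_Integration.integral_diff) auto
    finally have main: "z ^ (2 * k + 3) * (n z + (\<Sum>i<2*k+1. complex_of_real (s i) / z ^ (i + 1)))
      = of_real (- (\<integral>t. reg (2 * k + 2) y t \<partial>M)) - \<i> * y * of_real (\<integral>t. reg (2 * k + 1) y t \<partial>M)" .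
    have "expansion_remainder n s (2 * k + 2) y = n z + (\<Sum>i\<le>2*k+2. complex_of_real (s i) / z ^ (i + 1))"
      unfolding expansion_remainder_def z_def[symmetric] Let_def by (simp only: minus_divide_left[symmetric] sum_negf diff_minus_eq_add)
    also have "(\<Sum>i\<le>2*k+2. complex_of_real (s i) / z ^ (i + 1)) =
      (\<Sum>i<2*k+1. complex_of_real (s i) / z ^ (i + 1)) + s (2*k+1) / z ^ (2*k+2) + s (2*k+2) / z ^ (2*k+3)"
      by (simp add: lessThan_Suc_atMost[symmetric] numeral_3_eq_3)
    finally have "T y = z ^ (2 * k + 3) * (n z + (\<Sum>i<2*k+1. complex_of_real (s i) / z ^ (i + 1)))
      + z ^ (2 * k + 3) * (s (2*k+1) / z ^ (2*k+2) + s (2*k+2) / z ^ (2*k+3))"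
      unfolding T_def z_def[symmetric] by (simp add: ring_distribs)
    also have "z ^ (2 * k + 3) * (s (2*k+1) / z ^ (2*k+2) + s (2*k+2) / z ^ (2*k+3)) = z * s (2*k+1) + s (2*k+2)"
      using z by (simp add: field_simps power_add power2_eq_square power3_eq_cube)
    finally show ?thesis
      unfolding main by (simp add: z_def complex_eq_iff algebra_simps)
  qed
  have T0: "(T \<longlongrightarrow> 0) at_top"
    using exp unfolding truncated_expansion_def T_def by (simp add: numeral_3_eq_3)
  have "((\<lambda>y. s (2 * k + 2) - Re (T y)) \<longlongrightarrow> s (2 * k + 2) - Re 0) at_top"
    by (intro tendsto_intros T0)
  moreover have "\<forall>\<^sub>F y in at_top. s (2 * k + 2) - Re (T y) = (\<integral>t. reg (2 * k + 2) y t \<partial>M)"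
    using eventually_gt_at_top[of 0] by eventually_elim (simp add: T_eq)
  ultimately have "((\<lambda>y. \<integral>t. reg (2 * k + 2) y t \<partial>M) \<longlongrightarrow> s (2 * k + 2)) at_top"
    by (simp add: tendsto_cong)
  \<comment> \<open>The convergence theorems are applied along the sequence
    \<open>y = Suc i\<close>; the shift keeps \<open>y\<close> positive.\<close>
  moreover have seq: "filterlim (\<lambda>i. real (Suc i)) at_top sequentially"
    by (rule filterlim_compose[OF filterlim_real_sequentially filterlim_Suc])
  ultimately have even: "(\<lambda>i. \<integral>t. reg (2 * k + 2) (real (Suc i)) t \<partial>M) \<longlonglongrightarrow> s (2 * k + 2)"
    by (rule filterlim_compose)
  \<comment> \<open>The odd term in \<open>T y\<close> carries a factor \<open>y\<close>; dividing
    by it preserves convergence to zero.\<close>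
  have "((\<lambda>y. s (2 * k + 1) - Im (T y) * inverse y) \<longlongrightarrow> s (2 * k + 1) - Im 0 * 0) at_top"
    by (intro tendsto_intros T0 tendsto_inverse_0_at_top filterlim_ident)
  moreover have "\<forall>\<^sub>F y in at_top. s (2 * k + 1) - Im (T y) * inverse y = (\<integral>t. reg (2 * k + 1) y t \<partial>M)"
    using eventually_gt_at_top[of 0] by eventually_elim (simp add: T_eq field_simps)
  ultimately have "((\<lambda>y. \<integral>t. reg (2 * k + 1) y t \<partial>M) \<longlongrightarrow> s (2 * k + 1)) at_top"
    by (simp add: tendsto_cong)
  then have odd: "(\<lambda>i. \<integral>t. reg (2 * k + 1) (real (Suc i)) t \<partial>M) \<longlonglongrightarrow> s (2 * k + 1)"
    by (rule filterlim_compose[OF _ seq])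
  \<comment> \<open>In this form \<open>y\<close> occurs only in a denominator, so that monotonicity
    in \<open>y\<close> and the limit 1 can be read off.\<close>
  have kernel_eq: "y\<^sup>2 / (t\<^sup>2 + y\<^sup>2) = 1 - t\<^sup>2 / (t\<^sup>2 + y\<^sup>2)" if "y > 0" for y t :: real
  proof -
    have "t\<^sup>2 + y\<^sup>2 > 0"
      using that by (simp add: add_nonneg_pos)
    then show ?thesis
      by (auto simp: eq_diff_eq add_divide_distrib[symmetric] add.commute)
  qed
  have reg_lim: "(\<lambda>i. reg j (real (Suc i)) t) \<longlonglongrightarrow> t ^ j" for j t
  proof -
    have "filterlim (\<lambda>i. t\<^sup>2 + (real (Suc i))\<^sup>2) at_top sequentially"
      by (intro filterlim_tendsto_add_at_top[OF tendsto_const] filterlim_pow_at_top seq) simp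
    then have "(\<lambda>i. t ^ j * (1 - t\<^sup>2 * inverse (t\<^sup>2 + (real (Suc i))\<^sup>2))) \<longlonglongrightarrow> t ^ j * (1 - t\<^sup>2 * 0)"
      by (intro tendsto_intros tendsto_inverse_0_at_top)
    moreover have "(\<lambda>i. t ^ j * (1 - t\<^sup>2 * inverse (t\<^sup>2 + (real (Suc i))\<^sup>2))) = (\<lambda>i. reg j (real (Suc i)) t)"
      unfolding reg_def by (subst kernel_eq) (auto simp: divide_inverse)
    ultimately show ?thesis
      by simp
  qed
  have mono: "mono (\<lambda>i. reg (2 * k + 2) (real (Suc i)) t)" for t
  proof (rule monoI)
    fix i j :: nat
    assume "i \<le> j"
    then have "t\<^sup>2 + (real (Suc i))\<^sup>2 \<le> t\<^sup>2 + (real (Suc j))\<^sup>2"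
      by (intro add_left_mono power_mono) auto
    moreover have "t\<^sup>2 + (real (Suc i))\<^sup>2 > 0" for i
      by (intro add_nonneg_pos) auto
    ultimately have "t\<^sup>2 / (t\<^sup>2 + (real (Suc j))\<^sup>2) \<le> t\<^sup>2 / (t\<^sup>2 + (real (Suc i))\<^sup>2)"
      by (intro divide_left_mono mult_pos_pos) auto
    then show "reg (2 * k + 2) (real (Suc i)) t \<le> reg (2 * k + 2) (real (Suc j)) t"
      unfolding reg_def by (intro mult_left_mono zero_le_even_power) (auto simp: kernel_eq)
  qed
  have *: "has_bochner_integral M (\<lambda>t. t ^ (2 * k + 2)) (s (2 * k + 2))"
  proof (rule has_bochner_integral_monotone_convergence)
    show "integrable M (reg (2 * k + 2) (real (Suc i)))" for i
      by (rule int_reg) auto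
    show "AE t in M. mono (\<lambda>i. reg (2 * k + 2) (real (Suc i)) t)"
      using mono by simp
    show "AE t in M. (\<lambda>i. reg (2 * k + 2) (real (Suc i)) t) \<longlonglongrightarrow> t ^ (2 * k + 2)"
      by (intro AE_I2 reg_lim)
    show "(\<lambda>i. \<integral>t. reg (2 * k + 2) (real (Suc i)) t \<partial>M) \<longlonglongrightarrow> s (2 * k + 2)"
      by (rule even)
  qed measurable
  then show int2: "integrable M (\<lambda>t. t ^ (2 * k + 2))" and "s (2 * k + 2) = (\<integral>t. t ^ (2 * k + 2) \<partial>M)"
    by (auto simp: has_bochner_integral_iff)
  \<comment> \<open>The order matters: the dominating function is integrable because the moment of
    order \<open>2 * k + 2\<close> has just been shown to be finite.\<close>
  have "(\<lambda>i. \<integral>t. reg (2 * k + 1) (real (Suc i)) t \<partial>M) \<longlonglongrightarrow> (\<integral>t. t ^ (2 * k + 1) \<partial>M)"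
  proof (rule integral_dominated_convergence)
    show "integrable M (\<lambda>t. 1 + t ^ (2 * (k + 1)))"
      using int2 by simp
    show "AE t in M. (\<lambda>i. reg (2 * k + 1) (real (Suc i)) t) \<longlonglongrightarrow> t ^ (2 * k + 1)"
      by (intro AE_I2 reg_lim)
    have "norm (reg (2 * k + 1) (real (Suc i)) t) \<le> 1 + t ^ (2 * (k + 1))" for i t
    proof -
      have "0 \<le> (real (Suc i))\<^sup>2 / (t\<^sup>2 + (real (Suc i))\<^sup>2)"
        by simp
      moreover have "(real (Suc i))\<^sup>2 / (t\<^sup>2 + (real (Suc i))\<^sup>2) \<le> 1"
        by (subst kernel_eq) simp_all
      ultimately have "norm (reg (2 * k + 1) (real (Suc i)) t) \<le> \<bar>t ^ (2 * k + 1)\<bar> * 1"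
        unfolding reg_def real_norm_def abs_mult by (intro mult_left_mono) linarith+
      also have "\<dots> \<le> 1 + t ^ (2 * (k + 1))"
        using abs_power_le_one_plus_even_power[of "2 * k + 1" "k + 1" t] by simp
      finally show ?thesis .
    qed
    then show "AE t in M. norm (reg (2 * k + 1) (real (Suc i)) t) \<le> 1 + t ^ (2 * (k + 1))" for i
      by simp
  qed measurable
  with odd show "s (2 * k + 1) = (\<integral>t. t ^ (2 * k + 1) \<partial>M)"
    by (rule LIMSEQ_unique)
qed

text \<open>The start of the induction. The functions \<open>z / (t - z)\<close> are bounded by 1 on
  the imaginary axis and tend to -1, so \<open>z * n z\<close> tends to minus the total mass,
  whereas the expansion makes \<open>s 0 + z * n z\<close> tend to 0.\<close>

lemma zeroth_moment:
  fixes M :: "real measure"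
  assumes fin: "finite_measure M" and [measurable_cong]: "sets M = sets borel"
    and n: "\<And>z. z \<notin> \<real> \<Longrightarrow> n z = (\<integral>t. 1 / (complex_of_real t - z) \<partial>M)"
    and exp: "truncated_expansion n s 0"
  shows "s 0 = (\<integral>t. 1 \<partial>M)"
proof -
  interpret finite_measure M by fact
  define z where "z i = \<i> * complex_of_real (real (Suc i))" for i
  have z: "z i \<noteq> 0" "z i \<notin> \<real>" "cmod (z i) = real (Suc i)" for i
    by (auto simp: z_def complex_is_Real_iff norm_mult simp del: of_nat_Suc)
  have ge: "real (Suc i) \<le> cmod (complex_of_real t - z i)" for i t
    using abs_Im_le_cmod[of "complex_of_real t - z i"] by (simp add: z_def)
  have neq: "complex_of_real t - z i \<noteq> 0" for i t
    using ge[of i t] by auto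
  have "(\<lambda>i. \<integral>t. z i / (complex_of_real t - z i) \<partial>M) \<longlonglongrightarrow> (\<integral>t. - 1 \<partial>M)"
  proof (rule integral_dominated_convergence)
    show "integrable M (\<lambda>_. 1 :: real)"
      by simp
    have "cmod (z i / (complex_of_real t - z i)) \<le> 1" for i t
      using ge[of i t] by (simp add: norm_divide z divide_le_eq_1)
    then show "AE t in M. norm (z i / (complex_of_real t - z i)) \<le> 1" for i
      by simp
    have "(\<lambda>i. z i / (complex_of_real t - z i)) \<longlonglongrightarrow> - 1" for t
    proof -
      have "(\<lambda>i. z i / (complex_of_real t - z i) - (- 1)) \<longlonglongrightarrow> 0"
      proof (rule Lim_null_comparison)
        have "norm (z i / (complex_of_real t - z i) - (- 1)) \<le> \<bar>t\<bar> * inverse (real (Suc i))" for i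
        proof -
          have "z i / (complex_of_real t - z i) - (- 1) = complex_of_real t / (complex_of_real t - z i)"
            using neq[of t i] by (simp add: field_simps)
          also have "norm \<dots> \<le> \<bar>t\<bar> / real (Suc i)"
            unfolding norm_divide norm_of_real using ge[of i t] by (intro divide_left_mono mult_pos_pos) auto
          finally show ?thesis
            by (simp add: divide_inverse)
        qed
        then show "\<forall>\<^sub>F i in sequentially. norm (z i / (complex_of_real t - z i) - (- 1)) \<le> \<bar>t\<bar> * inverse (real (Suc i))"
          by simp
        show "(\<lambda>i. \<bar>t\<bar> * inverse (real (Suc i))) \<longlonglongrightarrow> 0"
          by (intro tendsto_mult_right_zero LIMSEQ_inverse_real_of_nat)
      qed
      then show ?thesis
        using LIM_zero_iff by blast
    qed
    then show "AE t in M. (\<lambda>i. z i / (complex_of_real t - z i)) \<longlonglongrightarrow> - 1"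
      by simp
  qed measurable
  then have "(\<lambda>i. s 0 + (\<integral>t. z i / (complex_of_real t - z i) \<partial>M)) \<longlonglongrightarrow> complex_of_real (s 0) + (\<integral>t. - 1 \<partial>M)"
    by (intro tendsto_intros)
  moreover have "(\<lambda>i. s 0 + (\<integral>t. z i / (complex_of_real t - z i) \<partial>M)) \<longlonglongrightarrow> 0"
  proof -
    have "filterlim (\<lambda>i. real (Suc i)) at_top sequentially"
      by (rule filterlim_compose[OF filterlim_real_sequentially filterlim_Suc])
    then have "(\<lambda>i. z i ^ (0 + 1) * expansion_remainder n s 0 (real (Suc i))) \<longlonglongrightarrow> 0"
      using exp unfolding truncated_expansion_def z_def by (rule filterlim_compose[rotated])
    moreover have "z i ^ (0 + 1) * expansion_remainder n s 0 (real (Suc i)) =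
        s 0 + (\<integral>t. z i / (complex_of_real t - z i) \<partial>M)" for i
    proof -
      have "z i * n (z i) = (\<integral>t. z i * (1 / (complex_of_real t - z i)) \<partial>M)"
        unfolding n[OF z(2)] by (rule Bochner_Integration.integral_mult_right_zero[symmetric])
      then show ?thesis
        using z(1)[of i] unfolding expansion_remainder_def z_def[symmetric] Let_def
        by (simp add: ring_distribs)
    qed
    ultimately show ?thesis
      by simp
  qed
  ultimately have "complex_of_real (s 0) + (\<integral>t. - 1 \<partial>M) = 0"
    by (rule LIMSEQ_unique)
  then have "complex_of_real (s 0) = complex_of_real (measure M (space M))"
    by (simp add: scaleR_conv_of_real)
  then show ?thesis
    by simp
qed

text \<open>The direction of the Hamburger-Nevanlinna theorem that leads from the expansion to the
  moments. Each induction step gains two orders, and the finiteness of the new even moment is part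
  of the conclusion.\<close>

lemma moments:
  fixes M :: "real measure"
  assumes fin: "finite_measure M" and sets: "sets M = sets borel"
    and n: "\<And>z. z \<notin> \<real> \<Longrightarrow> n z = (\<integral>t. 1 / (complex_of_real t - z) \<partial>M)"
    and exp: "truncated_expansion n s (2 * p)"
    and "k \<le> p"
  shows "integrable M (\<lambda>t. t ^ (2 * k)) \<and> (\<forall>i\<le>2*k. s i = (\<integral>t. t ^ i \<partial>M))"
  using \<open>k \<le> p\<close>
proof (induction k)
  case 0
  interpret finite_measure M by fact
  show ?case
    using zeroth_moment[OF fin sets n truncated_expansion_mono[OF exp]] by simp
next
  case (Suc k)
  then have int: "integrable M (\<lambda>t. t ^ (2 * k))"
    and mom: "\<And>i. i \<le> 2 * k \<Longrightarrow> s i = (\<integral>t. t ^ i \<partial>M)"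
    by auto
  have "truncated_expansion n s (2 * k + 2)"
    using Suc.prems by (intro truncated_expansion_mono[OF exp]) simp
  note step = next_moments[OF fin sets n this int mom]
  have "s i = (\<integral>t. t ^ i \<partial>M)" if "i \<le> 2 * Suc k" for i
  proof -
    have "i \<le> 2 * k \<or> i = 2 * k + 1 \<or> i = 2 * k + 2"
      using that by auto
    then show ?thesis
      using mom step(2,3) by blast
  qed
  then show ?case
    using step(1) by simp
qed

text \<open>A polynomial of norm zero vanishes almost everywhere, so it is orthogonal to every
  \<open>t ^ i\<close>. For \<open>i \<le> p\<close> these relations say that its coefficient vector
  lies in the kernel of the Hankel matrix.\<close>

lemma hankel_nondegenerate:
  fixes M :: "real measure"
  assumes moments: "\<And>i. i \<le> 2 * p \<Longrightarrow> integrable M (\<lambda>t. t ^ i)" "\<And>i. i \<le> 2 * p \<Longrightarrow> s i = (\<integral>t. t ^ i \<partial>M)"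
    and det: "hankel_det p s \<noteq> 0"
    and q: "degree q \<le> p" "(\<integral>t. (poly q t)\<^sup>2 \<partial>M) = 0"
  shows "q = 0"
proof (rule ccontr)
  assume "q \<noteq> 0"
  have int: "integrable M (\<lambda>t. poly r t)" if "degree r \<le> 2 * p" for r
    unfolding poly_altdef[abs_def] using moments(1) that by auto
  have "degree (q\<^sup>2) \<le> 2 * p"
    using q(1) by (simp add: degree_power_eq \<open>q \<noteq> 0\<close>)
  from int[OF this] have "integrable M (\<lambda>t. (poly q t)\<^sup>2)"
    by (simp add: poly_power[abs_def])
  then have AE: "AE t in M. poly q t = 0"
    using q(2) by (subst (asm) integral_nonneg_eq_0_iff_AE) auto
  define H where "H = Matrix.mat (p + 1) (p + 1) (\<lambda>(i, l). s (i + l))"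
  define a where "a = Matrix.vec (p + 1) (coeff q)"
  have "H *\<^sub>v a = 0\<^sub>v (p + 1)"
  proof (rule eq_vecI)
    fix i
    assume "i < dim_vec (0\<^sub>v (p + 1) :: real vec)"
    then have i: "i \<le> p"
      by simp
    have "(H *\<^sub>v a) $ i = (\<Sum>l\<le>p. s (i + l) * coeff q l)"
      using i by (simp add: H_def a_def scalar_prod_def atLeast0LessThan lessThan_Suc_atMost)
    also have "\<dots> = (\<Sum>l\<le>p. (\<integral>t. t ^ (i + l) * coeff q l \<partial>M))"
      using i by (intro sum.cong) (auto simp: moments)
    also have "\<dots> = (\<integral>t. (\<Sum>l\<le>p. t ^ (i + l) * coeff q l) \<partial>M)"
      using i moments(1) by (subst Bochner_Integration.integral_sum) auto
    also have "\<dots> = (\<integral>t. 0 \<partial>M)"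
    proof (rule integral_cong_AE)
      have *: "(\<Sum>l\<le>p. t ^ (i + l) * coeff q l) = t ^ i * poly q t" for t
      proof -
        have "poly q t = (\<Sum>l\<le>p. coeff q l * t ^ l)"
          unfolding poly_altdef using q(1) by (intro sum.mono_neutral_left) (auto simp: coeff_eq_0)
        then show ?thesis
          by (simp add: sum_distrib_left power_add mult_ac)
      qed
      show "AE t in M. (\<Sum>l\<le>p. t ^ (i + l) * coeff q l) = 0"
        unfolding * using AE by eventually_elim simp
      show "(\<lambda>t. \<Sum>l\<le>p. t ^ (i + l) * coeff q l) \<in> borel_measurable M"
        using i moments(1) by (intro borel_measurable_integrable Bochner_Integration.integrable_sum) auto
    qed simp
    finally show "(H *\<^sub>v a) $ i = 0\<^sub>v (p + 1) $ i"
      using i by simp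
  qed (simp add: H_def)
  moreover have "a \<noteq> 0\<^sub>v (p + 1)"
  proof
    assume "a = 0\<^sub>v (p + 1)"
    then have "a $ degree q = 0"
      using q(1) by simp
    then show False
      using q(1) \<open>q \<noteq> 0\<close> by (simp add: a_def)
  qed
  moreover have "H \<in> carrier_mat (p + 1) (p + 1)" "a \<in> carrier_vec (p + 1)"
    by (auto simp: H_def a_def)
  ultimately have "Determinant.det H = 0"
    using det_0_iff_vec_prod_zero by blast
  then show False
    using det by (simp add: hankel_det_def H_def)
qed

section \<open>Square integrable functions\<close>

lemma L2_mult_integrable:
  assumes "f \<in> L2 M" "g \<in> L2 M"
  shows "integrable M (\<lambda>t. f t * g t)"
proof (rule Bochner_Integration.integrable_bound)
  show "integrable M (\<lambda>t. (cmod (f t))\<^sup>2 + (cmod (g t))\<^sup>2)"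
    using assms by (simp add: L2_def)
  have "cmod (f t * g t) \<le> (cmod (f t))\<^sup>2 + (cmod (g t))\<^sup>2" for t
  proof -
    have "0 \<le> cmod (f t) * cmod (g t)"
      by simp
    then show ?thesis
      using sum_squares_bound[of "cmod (f t)" "cmod (g t)"] unfolding norm_mult by linarith
  qed
  then show "AE t in M. cmod (f t * g t) \<le> norm ((cmod (f t))\<^sup>2 + (cmod (g t))\<^sup>2)"
    by simp
  show "(\<lambda>t. f t * g t) \<in> borel_measurable M"
    using assms by (auto simp: L2_def)
qed

lemma L2_cmult: "f \<in> L2 M \<Longrightarrow> (\<lambda>t. c * f t) \<in> L2 M"
  by (auto simp: L2_def norm_mult power_mult_distrib)

lemma L2_cnj:
  assumes "f \<in> L2 M"
  shows "(\<lambda>t. cnj (f t)) \<in> L2 M"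
proof -
  have "cnj \<in> borel_measurable borel"
    by (intro borel_measurable_continuous_onI continuous_intros)
  then have "(\<lambda>t. cnj (f t)) \<in> borel_measurable M"
    using assms by (intro measurable_compose[of f M borel cnj]) (auto simp: L2_def)
  then show ?thesis
    using assms by (simp add: L2_def)
qed

lemma L2_add:
  assumes "f \<in> L2 M" "g \<in> L2 M"
  shows "(\<lambda>t. f t + g t) \<in> L2 M"
proof -
  have [measurable]: "f \<in> borel_measurable M" "g \<in> borel_measurable M"
    using assms by (auto simp: L2_def)
  have "integrable M (\<lambda>t. (cmod (f t + g t))\<^sup>2)"
  proof (rule Bochner_Integration.integrable_bound)
    show "integrable M (\<lambda>t. 2 * (cmod (f t))\<^sup>2 + 2 * (cmod (g t))\<^sup>2)"
      using assms by (simp add: L2_def)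
    have "(cmod (f t + g t))\<^sup>2 \<le> 2 * (cmod (f t))\<^sup>2 + 2 * (cmod (g t))\<^sup>2" for t
    proof -
      have "(cmod (f t + g t))\<^sup>2 \<le> (cmod (f t) + cmod (g t))\<^sup>2"
        by (intro power_mono norm_triangle_ineq) simp
      also have "\<dots> \<le> 2 * (cmod (f t))\<^sup>2 + 2 * (cmod (g t))\<^sup>2"
        using sum_squares_bound[of "cmod (f t)" "cmod (g t)"] by (simp add: power2_sum)
      finally show ?thesis .
    qed
    then show "AE t in M. norm ((cmod (f t + g t))\<^sup>2) \<le> norm (2 * (cmod (f t))\<^sup>2 + 2 * (cmod (g t))\<^sup>2)"
      by simp
  qed measurable
  then show ?thesis
    by (simp add: L2_def)
qed

lemma L2_diff: "f \<in> L2 M \<Longrightarrow> g \<in> L2 M \<Longrightarrow> (\<lambda>t. f t - g t) \<in> L2 M"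
  using L2_add[of f M "\<lambda>t. -1 * g t"] L2_cmult[of g M "-1"] by simp

lemma L2_sum: "(\<And>i. i \<in> I \<Longrightarrow> f i \<in> L2 M) \<Longrightarrow> (\<lambda>t. \<Sum>i\<in>I. f i t) \<in> L2 M"
proof (induction I rule: infinite_finite_induct)
  case (insert x F)
  then show ?case
    using L2_add[of "f x" M "\<lambda>t. \<Sum>i\<in>F. f i t"] by simp
qed (auto simp: L2_def)

lemma L2_self_inner: "L2_inner M f f = of_real (\<integral>t. (cmod (f t))\<^sup>2 \<partial>M)"
  unfolding L2_inner_def integral_complex_of_real[symmetric] complex_norm_square ..

lemma L2_inner_self_eq_0_imp:
  assumes "f \<in> L2 M" "L2_inner M f f = 0"
  shows "AE t in M. f t = 0"
proof -
  have "(\<integral>t. (cmod (f t))\<^sup>2 \<partial>M) = 0"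
    using assms(2) by (simp add: L2_self_inner)
  then have "AE t in M. (cmod (f t))\<^sup>2 = 0"
    using assms(1) by (subst (asm) integral_nonneg_eq_0_iff_AE) (auto simp: L2_def)
  then show ?thesis
    by simp
qed

text \<open>The quadratic form of multiplication by the variable is real, so multiplication by \<open>t - z\<close> has
  quadratic form with imaginary part \<open>- Im z * \<parallel>f\<parallel>\<^sup>2\<close>.\<close>

lemma AE_eq_0_if_shifted_form_eq_0:
  assumes "f \<in> L2 M" "(\<lambda>t. complex_of_real t * f t) \<in> L2 M" "z \<notin> \<real>"
    and 0: "(\<integral>t. (complex_of_real t - z) * f t * cnj (f t) \<partial>M) = 0"
  shows "AE t in M. f t = 0"
proof -
  have "integrable M (\<lambda>t. (complex_of_real t * f t - z * f t) * cnj (f t))"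
    using assms by (intro L2_mult_integrable L2_diff L2_cmult L2_cnj)
  then have "integrable M (\<lambda>t. (complex_of_real t - z) * f t * cnj (f t))"
    by (simp add: algebra_simps)
  then have "(\<integral>t. Im ((complex_of_real t - z) * f t * cnj (f t)) \<partial>M) = 0"
    using 0 by (subst integral_Im) auto
  moreover have "Im ((complex_of_real t - z) * f t * cnj (f t)) = - Im z * (cmod (f t))\<^sup>2" for t
    unfolding cmod_power2 by (simp add: algebra_simps power2_eq_square)
  ultimately have "(\<integral>t. (cmod (f t))\<^sup>2 \<partial>M) = 0"
    using assms(3) by (simp add: complex_is_Real_iff)
  then show ?thesis
    using assms(1) by (intro L2_inner_self_eq_0_imp) (simp_all add: L2_self_inner)
qed

section \<open>Orthogonal polynomials and the compression space\<close>

text \<open>Orthogonality to the span becomes a condition on degrees. Positivity of \<open>p\<close>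
  matters because the zero polynomial has degree 0.\<close>

lemma monomial_span_eq:
  assumes "p > 0"
  shows "monomial_span p = (\<lambda>q t. poly q (complex_of_real t)) ` {q. degree q < p}"
proof (intro equalityI subsetI)
  fix f
  assume "f \<in> monomial_span p"
  then obtain c where f: "f = (\<lambda>t. \<Sum>j<p. c j * complex_of_real t ^ j)"
    by (auto simp: monomial_span_def)
  have "degree (\<Sum>j<p. Polynomial.monom (c j) j) < p"
    using assms by (intro degree_sum_less) (auto intro: le_less_trans[OF degree_monom_le])
  moreover have "f = (\<lambda>t. poly (\<Sum>j<p. Polynomial.monom (c j) j) (complex_of_real t))"
    by (simp add: f poly_sum poly_monom)
  ultimately show "f \<in> (\<lambda>q t. poly q (complex_of_real t)) ` {q. degree q < p}"
    by blast
next
  fix f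
  assume "f \<in> (\<lambda>q t. poly q (complex_of_real t)) ` {q. degree q < p}"
  then obtain q where q: "degree q < p" and f: "f = (\<lambda>t. poly q (complex_of_real t))"
    by auto
  have "poly q x = (\<Sum>j<p. coeff q j * x ^ j)" for x
    unfolding poly_altdef using q by (intro sum.mono_neutral_left) (auto simp: coeff_eq_0)
  then show "f \<in> monomial_span p"
    unfolding f monomial_span_def by auto
qed

lemma poly_map_of_real: "poly (map_poly complex_of_real q) (complex_of_real t) = complex_of_real (poly q t)"
  by (induction q) (auto simp: map_poly_pCons)

text \<open>The interface between the two halves of the proof: it records what the expansion and the
  Hankel condition give, and inside it only the measure is studied.\<close>

locale moment_space = finite_measure M for M :: "real measure" +
  fixes p :: nat
  assumes sets_M [measurable_cong]: "sets M = sets borel"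
    and p_pos: "p > 0"
    and integrable_moment: "\<And>j. j \<le> 2 * p \<Longrightarrow> integrable M (\<lambda>t. t ^ j)"
    and nondegenerate: "\<And>q. degree q \<le> p \<Longrightarrow> (\<integral>t. (poly q t)\<^sup>2 \<partial>M) = 0 \<Longrightarrow> q = 0"
begin

lemma integrable_poly: "degree q \<le> 2 * p \<Longrightarrow> integrable M (poly q)"
  unfolding poly_altdef[abs_def] using integrable_moment by auto

lemma poly_L2:
  assumes "degree q \<le> p"
  shows "(\<lambda>t. poly q (complex_of_real t)) \<in> L2 M"
proof -
  have "(\<lambda>t. complex_of_real t ^ j) \<in> L2 M" if "j \<le> p" for j
  proof -
    have "integrable M (\<lambda>t. t ^ (2 * j))"
      using that by (intro integrable_moment) simp
    then show ?thesis
      by (auto simp: L2_def norm_power power_mult power2_eq_square power_mult_distrib power_even_abs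
          simp flip: power_mult_distrib)
  qed
  then show ?thesis
    unfolding poly_altdef using assms by (intro L2_sum L2_cmult) auto
qed

lemma integrable_mult_poly:
  assumes "f \<in> L2 M" "degree q \<le> p"
  shows "integrable M (\<lambda>t. f t * poly q (complex_of_real t))"
  using assms by (intro L2_mult_integrable poly_L2)

text \<open>One strong induction proves everything together: orthogonality at \<open>k\<close> uses
  orthonormality of the earlier polynomials, and the normalizing constant is positive because the
  unnormalized polynomial is monic of degree \<open>k\<close>, hence not of norm zero.\<close>

lemma first_kind_gram_schmidt:
  assumes "k \<le> p"
  shows "degree (first_kind M k) = k \<and> lead_coeff (first_kind M k) > 0 \<and>
    (\<integral>t. poly (first_kind M k) t * poly (first_kind M k) t \<partial>M) = 1 \<and>
    (\<forall>j<k. (\<integral>t. poly (first_kind M j) t * poly (first_kind M k) t \<partial>M) = 0)"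
  using assms
proof (induction k rule: less_induct)
  case (less k)
  let ?e = "first_kind M"
  define c where "c j = (\<integral>t. t ^ k * poly (?e j) t \<partial>M)" for j
  define S where "S = (\<Sum>j<k. Polynomial.smult (c j) (?e j))"
  define q where "q = Polynomial.monom 1 k - S"
  define N where "N = (\<integral>t. (poly q t)\<^sup>2 \<partial>M)"
  have deg: "degree (?e j) = j" if "j < k" for j
    using less that by simp
  have orth: "(\<integral>t. poly (?e i) t * poly (?e j) t \<partial>M) = (if i = j then 1 else 0)" if "i < k" "j < k" for i j
  proof (cases i j rule: linorder_cases)
    case greater
    then have "(\<integral>t. poly (?e j) t * poly (?e i) t \<partial>M) = 0"
      using less that by simp
    with greater show ?thesis
      by (simp add: mult.commute)
  qed (use less that in auto)
  have e_k: "?e k = Polynomial.smult (1 / sqrt N) q"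
    unfolding N_def q_def S_def c_def Let_def
    by (subst first_kind.simps) (simp add: interv_sum_list_conv_sum_set_nat atLeast0LessThan Let_def)
  have "coeff S k = 0"
    unfolding S_def by (simp add: coeff_sum coeff_eq_0 deg)
  then have qk: "coeff q k = 1"
    by (simp add: q_def)
  have degS: "degree S \<le> k"
    unfolding S_def by (intro degree_sum_le) (auto simp: deg intro: order_trans[OF degree_smult_le])
  then have "degree q \<le> k"
    unfolding q_def by (intro degree_diff_le) (auto intro: degree_monom_le)
  moreover have "k \<le> degree q"
    using qk by (intro le_degree) simp
  ultimately have dq: "degree q = k"
    by simp
  have "N \<noteq> 0"
    using nondegenerate[of q] qk dq less.prems unfolding N_def by (auto simp: power2_eq_square)
  moreover have "N \<ge> 0"
    unfolding N_def by (rule Bochner_Integration.integral_nonneg) simp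
  ultimately have N: "N > 0"
    by simp
  have "degree (?e k) = k" "lead_coeff (?e k) > 0"
    using N by (simp_all add: e_k dq qk)
  have "(\<lambda>t. poly (?e k) t * poly (?e k) t) = (\<lambda>t. (poly q t)\<^sup>2 / N)"
    using N by (simp add: e_k power2_eq_square field_simps)
  then have "(\<integral>t. poly (?e k) t * poly (?e k) t \<partial>M) = 1"
    using N by (simp add: N_def)
  moreover have "\<forall>j<k. (\<integral>t. poly (?e j) t * poly (?e k) t \<partial>M) = 0"
  proof safe
    fix j
    assume j: "j < k"
    have int: "integrable M (\<lambda>t. poly (?e j) t * poly r t)" if "degree r \<le> k" for r
    proof -
      have "degree (?e j * r) \<le> 2 * p"
        using degree_mult_le[of "?e j" r] deg[OF j] that j less.prems by linarith
      moreover have "poly (?e j * r) = (\<lambda>t. poly (?e j) t * poly r t)"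
        by auto
      ultimately show ?thesis
        using integrable_poly[of "?e j * r"] by simp
    qed
    have "(\<integral>t. poly (?e j) t * poly q t \<partial>M) =
      (\<integral>t. poly (?e j) t * poly (Polynomial.monom 1 k) t - poly (?e j) t * poly S t \<partial>M)"
      by (simp add: q_def algebra_simps)
    also have "\<dots> = c j - (\<integral>t. poly (?e j) t * poly S t \<partial>M)"
      using int[of S] int[of "Polynomial.monom 1 k"] degS
      by (simp add: c_def poly_monom degree_monom_le mult.commute)
    also have "(\<integral>t. poly (?e j) t * poly S t \<partial>M) = (\<integral>t. (\<Sum>i<k. c i * (poly (?e j) t * poly (?e i) t)) \<partial>M)"
      by (simp add: S_def poly_sum sum_distrib_left mult_ac)
    also have "\<dots> = (\<Sum>i<k. c i * (\<integral>t. poly (?e j) t * poly (?e i) t \<partial>M))"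
      using int deg by (subst Bochner_Integration.integral_sum) auto
    also have "\<dots> = c j"
      using j by (simp add: orth if_distrib cong: if_cong)
    finally show "(\<integral>t. poly (?e j) t * poly (?e k) t \<partial>M) = 0"
      by (simp add: e_k)
  qed
  ultimately show ?case
    using \<open>degree (?e k) = k\<close> \<open>lead_coeff (?e k) > 0\<close> by blast
qed

lemmas first_kind_orthonormal = first_kind_gram_schmidt[THEN conjunct1]
  first_kind_gram_schmidt[THEN conjunct2, THEN conjunct1]
  first_kind_gram_schmidt[THEN conjunct2, THEN conjunct2, THEN conjunct1]
  first_kind_gram_schmidt[THEN conjunct2, THEN conjunct2, THEN conjunct2]

section \<open>The orthonormal polynomials over the complex numbers as a basis\<close>

abbreviation E :: "nat \<Rightarrow> complex poly" where
  "E k \<equiv> map_poly complex_of_real (first_kind M k)"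

lemma coeff_E: "coeff (E k) i = complex_of_real (coeff (first_kind M k) i)"
  by (simp add: coeff_map_poly)

lemma degree_E: "k \<le> p \<Longrightarrow> degree (E k) = k"
  using first_kind_orthonormal(1)[of k] by (simp add: degree_map_poly)

lemma lead_coeff_E_neq_0: "k \<le> p \<Longrightarrow> coeff (E k) k \<noteq> 0"
  using first_kind_orthonormal(1,2)[of k] by (simp add: coeff_E)

lemma E_orthonormal:
  assumes "i \<le> p" "j \<le> p"
  shows "(\<integral>t. poly (E i) (complex_of_real t) * poly (E j) (complex_of_real t) \<partial>M) = (if i = j then 1 else 0)"
proof -
  have "(\<integral>t. poly (first_kind M i) t * poly (first_kind M j) t \<partial>M) = (if i = j then 1 else 0)"
    using first_kind_orthonormal[OF assms(1)] first_kind_orthonormal[OF assms(2)]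
    by (cases i j rule: linorder_cases) (auto simp: mult.commute)
  then show ?thesis
    by (simp add: poly_map_of_real flip: of_real_mult)
qed

lemma E_L2: "k \<le> p \<Longrightarrow> (\<lambda>t. poly (E k) (complex_of_real t)) \<in> L2 M"
  by (intro poly_L2) (simp add: degree_E)

text \<open>Leading terms are eliminated one degree at a time, since \<open>E k\<close> has degree
  exactly \<open>k\<close>.\<close>

lemma E_span:
  assumes "m \<le> p" "degree q \<le> m"
  shows "\<exists>c. q = (\<Sum>k\<le>m. Polynomial.smult (c k) (E k))"
  using assms
proof (induction m arbitrary: q)
  case 0
  then obtain a where a: "q = [:a:]"
    using degree_eq_zeroE by blast
  obtain b where b: "E 0 = [:b:]" "b \<noteq> 0"
    using degree_E[of 0] lead_coeff_E_neq_0[of 0] by (metis coeff_pCons_0 degree_eq_zeroE le0)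
  show ?case
    by (rule exI[of _ "\<lambda>_. a / b"]) (simp add: a b)
next
  case (Suc m)
  define a where "a = coeff q (Suc m) / coeff (E (Suc m)) (Suc m)"
  have "degree (q - Polynomial.smult a (E (Suc m))) \<le> m"
  proof (rule degree_le, safe)
    fix i
    assume "m < i"
    show "coeff (q - Polynomial.smult a (E (Suc m))) i = 0"
    proof (cases "i = Suc m")
      case True
      then show ?thesis
        using lead_coeff_E_neq_0[of "Suc m"] Suc.prems by (simp add: a_def)
    next
      case False
      then show ?thesis
        using \<open>m < i\<close> Suc.prems degree_E[of "Suc m"] by (simp add: coeff_eq_0)
    qed
  qed
  then obtain c where c: "q - Polynomial.smult a (E (Suc m)) = (\<Sum>k\<le>m. Polynomial.smult (c k) (E k))"
    using Suc by (meson Suc_leD)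
  have "(\<Sum>k\<le>m. Polynomial.smult ((c(Suc m := a)) k) (E k)) = (\<Sum>k\<le>m. Polynomial.smult (c k) (E k))"
    by (rule sum.cong) auto
  then have "q = (\<Sum>k\<le>Suc m. Polynomial.smult ((c(Suc m := a)) k) (E k))"
    using c by (simp add: algebra_simps)
  then show ?case
    by blast
qed

text \<open>The \<open>E k\<close> are real on the real axis, so the Fourier coefficients are
  bilinear integrals without conjugation.\<close>

lemma E_expansion:
  assumes "degree q \<le> p"
  shows "q = (\<Sum>k\<le>p. Polynomial.smult
    (\<integral>t. poly q (complex_of_real t) * poly (E k) (complex_of_real t) \<partial>M) (E k))"
proof -
  obtain c where c: "q = (\<Sum>k\<le>p. Polynomial.smult (c k) (E k))"
    using E_span[OF order_refl assms] by blast
  have "(\<integral>t. poly q (complex_of_real t) * poly (E k) (complex_of_real t) \<partial>M) = c k" if k: "k \<le> p" for k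
  proof -
    have "poly q x * y = (\<Sum>i\<le>p. c i * (poly (E i) x * y))" for x y
      unfolding c by (simp add: poly_sum sum_distrib_right mult.assoc)
    then have "(\<integral>t. poly q (complex_of_real t) * poly (E k) (complex_of_real t) \<partial>M) =
      (\<integral>t. (\<Sum>i\<le>p. c i * (poly (E i) (complex_of_real t) * poly (E k) (complex_of_real t))) \<partial>M)"
      by simp
    also have "\<dots> = (\<Sum>i\<le>p. c i * (\<integral>t. poly (E i) (complex_of_real t) * poly (E k) (complex_of_real t) \<partial>M))"
      using L2_mult_integrable[OF E_L2 E_L2] k by (subst Bochner_Integration.integral_sum) auto
    also have "\<dots> = c k"
      using k by (simp add: E_orthonormal if_distrib cong: if_cong)
    finally show ?thesis .
  qed
  then have "(\<Sum>k\<le>p. Polynomial.smult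
      (\<integral>t. poly q (complex_of_real t) * poly (E k) (complex_of_real t) \<partial>M) (E k)) =
      (\<Sum>k\<le>p. Polynomial.smult (c k) (E k))"
    by (intro sum.cong) auto
  then show ?thesis
    using c by simp
qed

section \<open>The orthogonal complement of the low-degree polynomials and its projection\<close>

abbreviation K :: "l2_vec set" where
  "K \<equiv> L2_ominus M (monomial_span p)"

lemma mem_K_iff:
  "f \<in> K \<longleftrightarrow> f \<in> L2 M \<and> (\<forall>q. degree q < p \<longrightarrow> (\<integral>t. f t * poly q (complex_of_real t) \<partial>M) = 0)"
proof -
  have inner: "L2_inner M f (\<lambda>t. poly q (complex_of_real t)) =
      (\<integral>t. f t * poly (map_poly cnj q) (complex_of_real t) \<partial>M)" for q
    by (simp add: L2_inner_def)
  have "degree (map_poly cnj q) = degree q" "map_poly cnj (map_poly cnj q) = q" for q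
    by (simp_all add: degree_map_poly map_poly_map_poly o_def)
  then have conj: "(\<forall>q. degree q < p \<longrightarrow> P (map_poly cnj q)) \<longleftrightarrow> (\<forall>q. degree q < p \<longrightarrow> P q)" for P
    by metis
  have "f \<in> K \<longleftrightarrow> f \<in> L2 M \<and> (\<forall>q. degree q < p \<longrightarrow> L2_inner M f (\<lambda>t. poly q (complex_of_real t)) = 0)"
    unfolding L2_ominus_def monomial_span_eq[OF p_pos] by auto
  also have "\<dots> \<longleftrightarrow> f \<in> L2 M \<and> (\<forall>q. degree q < p \<longrightarrow> (\<integral>t. f t * poly q (complex_of_real t) \<partial>M) = 0)"
    unfolding inner by (simp only: conj[of "\<lambda>q. (\<integral>t. f t * poly q (complex_of_real t) \<partial>M) = 0"])
  finally show ?thesis .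
qed

lemma K_L2: "f \<in> K \<Longrightarrow> f \<in> L2 M"
  by (simp add: mem_K_iff)

lemma K_orthogonal: "f \<in> K \<Longrightarrow> degree q < p \<Longrightarrow> (\<integral>t. f t * poly q (complex_of_real t) \<partial>M) = 0"
  by (simp add: mem_K_iff)

lemma mem_K_if_orthogonal_E:
  assumes f: "f \<in> L2 M" and "\<And>j. j < p \<Longrightarrow> (\<integral>t. f t * poly (E j) (complex_of_real t) \<partial>M) = 0"
  shows "f \<in> K"
  unfolding mem_K_iff
proof (intro conjI f allI impI)
  fix q :: "complex poly"
  assume "degree q < p"
  then have "degree q \<le> p - 1"
    by simp
  then obtain c where c: "q = (\<Sum>k\<le>p-1. Polynomial.smult (c k) (E k))"
    using E_span[of "p - 1" q] diff_le_self by blast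
  have "y * poly q x = (\<Sum>k\<le>p-1. c k * (y * poly (E k) x))" for x y
    unfolding c by (simp add: poly_sum sum_distrib_left mult.left_commute)
  then have "(\<integral>t. f t * poly q (complex_of_real t) \<partial>M) =
      (\<integral>t. (\<Sum>k\<le>p-1. c k * (f t * poly (E k) (complex_of_real t))) \<partial>M)"
    by simp
  also have "\<dots> = (\<Sum>k\<le>p-1. c k * (\<integral>t. f t * poly (E k) (complex_of_real t) \<partial>M))"
    using L2_mult_integrable[OF f E_L2] by (subst Bochner_Integration.integral_sum) auto
  also have "\<dots> = 0"
  proof (intro sum.neutral ballI)
    fix k
    assume "k \<in> {..p-1}"
    then have "k < p"
      using p_pos by (cases p) auto
    then show "c k * (\<integral>t. f t * poly (E k) (complex_of_real t) \<partial>M) = 0"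
      by (simp add: assms(2))
  qed
  finally show "(\<integral>t. f t * poly q (complex_of_real t) \<partial>M) = 0" .
qed

lemma K_cmult:
  assumes "f \<in> K"
  shows "(\<lambda>t. c * f t) \<in> K"
proof -
  have "(\<integral>t. c * f t * poly q (complex_of_real t) \<partial>M) = 0" if "degree q < p" for q
    unfolding mult.assoc using K_orthogonal[OF assms that] by simp
  then show ?thesis
    using L2_cmult[OF K_L2[OF assms]] unfolding mem_K_iff by blast
qed

lemma K_add:
  assumes "f \<in> K" "g \<in> K"
  shows "(\<lambda>t. f t + g t) \<in> K"
proof -
  have "(\<integral>t. (f t + g t) * poly q (complex_of_real t) \<partial>M) = 0" if "degree q < p" for q
    unfolding distrib_right
    using assms[THEN K_orthogonal, OF that] assms[THEN K_L2, THEN integrable_mult_poly, of q] that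
    by (subst Bochner_Integration.integral_add) auto
  then show ?thesis
    using L2_add[OF assms[THEN K_L2]] unfolding mem_K_iff by blast
qed

lemma K_diff:
  assumes "f \<in> K" "g \<in> K"
  shows "(\<lambda>t. f t - g t) \<in> K"
  using K_add[OF assms(1) K_cmult[OF assms(2), of "-1"]] by simp

text \<open>Holds because the span has the real basis \<open>E j\<close>. It lets a bilinear
  integral against an element of \<open>K\<close> be read as an inner product with an element of
  \<open>K\<close>.\<close>

lemma K_cnj:
  assumes "f \<in> K"
  shows "(\<lambda>t. cnj (f t)) \<in> K"
proof -
  have "(\<integral>t. cnj (f t) * poly (E j) (complex_of_real t) \<partial>M) = 0" if "j < p" for j
  proof -
    have "(\<integral>t. f t * poly (E j) (complex_of_real t) \<partial>M) = 0"
      using that by (intro K_orthogonal assms) (simp add: degree_E)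
    then have "(\<integral>t. cnj (f t * poly (E j) (complex_of_real t)) \<partial>M) = 0"
      by (simp only: Bochner_Integration.integral_cnj complex_cnj_zero)
    then show ?thesis
      by (simp add: poly_map_of_real)
  qed
  then show ?thesis
    using assms by (intro mem_K_if_orthogonal_E) (auto simp: L2_cnj K_L2)
qed

lemma E_top_in_K: "(\<lambda>t. poly (E p) (complex_of_real t)) \<in> K"
  by (rule mem_K_if_orthogonal_E) (auto simp: E_L2 E_orthonormal)

lemma poly_orthogonal_K:
  assumes "degree q < p" "h \<in> K"
  shows "L2_inner M (\<lambda>t. poly q (complex_of_real t)) h = 0"
  using K_orthogonal[OF K_cnj[OF assms(2)] assms(1)] by (simp add: L2_inner_def mult.commute)

text \<open>Removing the finite Fourier sum is the projection onto \<open>K\<close> in explicit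
  form. It yields both the existence of projections and the element \<open>v\<close> below.\<close>

lemma L2_minus_coefficients_in_K:
  assumes f: "f \<in> L2 M"
  shows "(\<lambda>t. f t - (\<Sum>j<p. (\<integral>x. f x * poly (E j) (complex_of_real x) \<partial>M) * poly (E j) (complex_of_real t))) \<in> K"
    (is "?g \<in> K")
proof (rule mem_K_if_orthogonal_E)
  show "?g \<in> L2 M"
    using f by (intro L2_diff L2_sum L2_cmult E_L2) auto
  fix i
  assume i: "i < p"
  define a where "a j = (\<integral>x. f x * poly (E j) (complex_of_real x) \<partial>M)" for j
  have int: "integrable M (\<lambda>t. poly (E j) (complex_of_real t) * poly (E i) (complex_of_real t))" if "j < p" for j
    using that i by (intro L2_mult_integrable E_L2) auto
  have "(\<integral>t. ?g t * poly (E i) (complex_of_real t) \<partial>M) =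
      (\<integral>t. f t * poly (E i) (complex_of_real t) -
        (\<Sum>j<p. a j * (poly (E j) (complex_of_real t) * poly (E i) (complex_of_real t))) \<partial>M)"
    by (simp add: a_def left_diff_distrib sum_distrib_right mult.assoc)
  also have "\<dots> = a i - (\<Sum>j<p. a j * (\<integral>t. poly (E j) (complex_of_real t) * poly (E i) (complex_of_real t) \<partial>M))"
    using L2_mult_integrable[OF f E_L2[of i]] i int
    by (subst Bochner_Integration.integral_diff) (auto simp: a_def)
  also have "\<dots> = 0"
    using i by (simp add: E_orthonormal if_distrib cong: if_cong)
  finally show "(\<integral>t. ?g t * poly (E i) (complex_of_real t) \<partial>M) = 0" .
qed

text \<open>As \<open>L2_proj\<close> is a choice, its defining properties become available once a
  witness is exhibited.\<close>

lemma L2_proj_K: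
  assumes f: "f \<in> L2 M"
  shows "L2_proj M K f \<in> K" "\<And>h. h \<in> K \<Longrightarrow> L2_inner M (\<lambda>t. f t - L2_proj M K f t) h = 0"
proof -
  define S where "S = (\<Sum>j<p. Polynomial.smult (\<integral>x. f x * poly (E j) (complex_of_real x) \<partial>M) (E j))"
  have "degree S < p"
    unfolding S_def using p_pos
    by (intro degree_sum_less) (auto simp: degree_E intro: le_less_trans[OF degree_smult_le])
  then have "L2_inner M (\<lambda>t. f t - (f t - poly S (complex_of_real t))) h = 0" if "h \<in> K" for h
    using poly_orthogonal_K[OF _ that] by simp
  moreover have "(\<lambda>t. f t - poly S (complex_of_real t)) \<in> K"
    using L2_minus_coefficients_in_K[OF f] by (simp add: S_def poly_sum)
  ultimately have "\<exists>g. g \<in> K \<and> (\<forall>h\<in>K. L2_inner M (\<lambda>t. f t - g t) h = 0)"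
    by blast
  from someI_ex[OF this]
  show "L2_proj M K f \<in> K" "\<And>h. h \<in> K \<Longrightarrow> L2_inner M (\<lambda>t. f t - L2_proj M K f t) h = 0"
    unfolding L2_proj_def by auto
qed

text \<open>The difference of two projections lies in \<open>K\<close> and is orthogonal to
  \<open>K\<close>, in particular to itself.\<close>

lemma L2_proj_K_unique:
  assumes f: "f \<in> L2 M" and g: "g \<in> K" "\<And>h. h \<in> K \<Longrightarrow> L2_inner M (\<lambda>t. f t - g t) h = 0"
  shows "AE t in M. L2_proj M K f t = g t"
proof -
  define k where "k = (\<lambda>t. L2_proj M K f t - g t)"
  have k: "k \<in> K"
    unfolding k_def by (intro K_diff L2_proj_K f g)
  have "L2_inner M k k = L2_inner M (\<lambda>t. f t - g t) k - L2_inner M (\<lambda>t. f t - L2_proj M K f t) k"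
  proof -
    have "integrable M (\<lambda>t. (f t - h t) * cnj (k t))" if "h \<in> K" for h
      by (rule L2_mult_integrable[OF L2_diff[OF f K_L2[OF that]] L2_cnj[OF K_L2[OF k]]])
    then have "L2_inner M (\<lambda>t. f t - g t) k - L2_inner M (\<lambda>t. f t - L2_proj M K f t) k =
        (\<integral>t. (f t - g t) * cnj (k t) - (f t - L2_proj M K f t) * cnj (k t) \<partial>M)"
      unfolding L2_inner_def by (simp only: Bochner_Integration.integral_diff g L2_proj_K[OF f])
    also have "(\<lambda>t. (f t - g t) * cnj (k t) - (f t - L2_proj M K f t) * cnj (k t)) = (\<lambda>t. k t * cnj (k t))"
      unfolding left_diff_distrib[symmetric] by (simp add: k_def)
    finally show ?thesis
      by (simp add: L2_inner_def)
  qed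
  then have "L2_inner M k k = 0"
    using L2_proj_K(2)[OF f k] g(2)[OF k] by simp
  then have "AE t in M. k t = 0"
    by (intro L2_inner_self_eq_0_imp K_L2 k)
  then show ?thesis
    by (simp add: k_def)
qed

section \<open>The resolvent of the compression\<close>

text \<open>The off-diagonal Jacobi coefficient coupling the degrees \<open>p - 1\<close> and
  \<open>p\<close>, taken as a real number so that its sign can be discussed.\<close>

definition \<beta> :: real where
  "\<beta> = (\<integral>t. t * poly (first_kind M (p - 1)) t * poly (first_kind M p) t \<partial>M)"

text \<open>The part of the three-term recurrence that is visible modulo degree less than
  \<open>p\<close>; the lower terms are annihilated by \<open>K\<close>. Comparing coefficients of
  degree \<open>p\<close> gives the second claim, from which positivity of \<open>\<beta>\<close>
  follows.\<close>

lemma recurrence_top: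
  "degree (pCons 0 (E (p - 1)) - Polynomial.smult (of_real \<beta>) (E p)) < p"
  "lead_coeff (first_kind M (p - 1)) = \<beta> * lead_coeff (first_kind M p)"
proof -
  define X where "X = pCons 0 (E (p - 1))"
  define a where "a k = (\<integral>t. poly X (complex_of_real t) * poly (E k) (complex_of_real t) \<partial>M)" for k
  have "degree X \<le> Suc (degree (E (p - 1)))"
    unfolding X_def by (rule degree_pCons_le)
  then have "degree X \<le> p"
    using degree_E[of "p - 1"] p_pos by simp
  then have X: "X = (\<Sum>k\<le>p. Polynomial.smult (a k) (E k))"
    unfolding a_def by (rule E_expansion)
  have "a p = complex_of_real \<beta>"
    by (simp add: a_def X_def \<beta>_def poly_map_of_real flip: of_real_mult)
  moreover have "{..p} = insert p {..<p}"
    by auto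
  ultimately have diff: "X - Polynomial.smult (of_real \<beta>) (E p) = (\<Sum>k<p. Polynomial.smult (a k) (E k))"
    using X by simp
  have "degree (\<Sum>k<p. Polynomial.smult (a k) (E k)) < p"
    using p_pos by (intro degree_sum_less) (auto simp: degree_E intro: le_less_trans[OF degree_smult_le])
  then show deg: "degree (pCons 0 (E (p - 1)) - Polynomial.smult (of_real \<beta>) (E p)) < p"
    using diff by (simp add: X_def)
  then have "coeff (pCons 0 (E (p - 1)) - Polynomial.smult (of_real \<beta>) (E p)) p = 0"
    by (rule coeff_eq_0)
  then have "coeff (E (p - 1)) (p - 1) = of_real \<beta> * coeff (E p) p"
    using p_pos by (cases p) (auto simp: coeff_pCons)
  then show "lead_coeff (first_kind M (p - 1)) = \<beta> * lead_coeff (first_kind M p)"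
    using first_kind_orthonormal(1)[of p] first_kind_orthonormal(1)[of "p - 1"]
    by (simp add: coeff_E flip: of_real_mult)
qed

lemma \<beta>_pos: "\<beta> > 0"
  using recurrence_top(2) first_kind_orthonormal(2)[of p] first_kind_orthonormal(2)[of "p - 1"]
  by (metis diff_le_self order_refl zero_less_mult_pos2)

section \<open>The projected Cauchy kernel and the resolvents at a fixed nonreal point\<close>

context
  fixes z :: complex
  assumes z: "z \<notin> \<real>"
begin

lemma kernel_bounded:
  obtains B where "\<And>t. cmod (1 / (complex_of_real t - z)) \<le> B"
proof
  have "Im z \<noteq> 0"
    using z by (simp add: complex_is_Real_iff)
  then show "cmod (1 / (complex_of_real t - z)) \<le> 1 / \<bar>Im z\<bar>" for t
    using abs_Im_le_cmod[of "complex_of_real t - z"]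
    by (auto simp: norm_divide intro!: divide_left_mono mult_pos_pos)
qed

lemma minus_z_neq_0: "complex_of_real t - z \<noteq> 0"
  using z by auto

lemma kernel_L2: "(\<lambda>t. 1 / (complex_of_real t - z)) \<in> L2 M"
proof -
  obtain B where B: "\<And>t. cmod (1 / (complex_of_real t - z)) \<le> B"
    using kernel_bounded by blast
  have "integrable M (\<lambda>t. (cmod (1 / (complex_of_real t - z)))\<^sup>2)"
  proof (rule integrable_const_bound[where B = "B\<^sup>2"])
    show "AE t in M. norm ((cmod (1 / (complex_of_real t - z)))\<^sup>2) \<le> B\<^sup>2"
      using power_mono[OF B norm_ge_zero, of _ 2] by simp
  qed measurable
  then show ?thesis
    by (simp add: L2_def)
qed

definition w :: "nat \<Rightarrow> complex" where
  "w k = (\<integral>t. 1 / (complex_of_real t - z) * poly (E k) (complex_of_real t) \<partial>M)"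

definition S :: "complex poly" where
  "S = (\<Sum>j<p. Polynomial.smult (w j) (E j))"

definition v :: "real \<Rightarrow> complex" where
  "v t = 1 / (complex_of_real t - z) - poly S (complex_of_real t)"

text \<open>Writing \<open>e\<^sub>k(t) = e\<^sub>k(z) + (e\<^sub>k(t) - e\<^sub>k(z))\<close>
  splits the integral; the difference quotient is the integrand of the polynomial of the second
  kind.\<close>

lemma w_eq:
  assumes "k \<le> p"
  shows "w k = cpoly (first_kind M k) z * (\<integral>t. 1 / (complex_of_real t - z) \<partial>M) + second_kind M k z"
proof -
  have int: "integrable M (\<lambda>t. 1 / (complex_of_real t - z))"
    using L2_mult_integrable[OF kernel_L2 poly_L2[of 1]] by simp
  have int': "integrable M (\<lambda>t. 1 / (complex_of_real t - z) * poly (E k) (complex_of_real t))"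
    using L2_mult_integrable[OF kernel_L2 E_L2[OF assms]] .
  have "(poly (E k) z - poly (E k) (complex_of_real t)) / (z - complex_of_real t)
      = 1 / (complex_of_real t - z) * poly (E k) (complex_of_real t) - poly (E k) z * (1 / (complex_of_real t - z))" for t
    using minus_z_neq_0[of t] by (auto simp: divide_simps) (simp add: algebra_simps)
  then have "second_kind M k z = (\<integral>t. 1 / (complex_of_real t - z) * poly (E k) (complex_of_real t)
      - poly (E k) z * (1 / (complex_of_real t - z)) \<partial>M)"
    unfolding second_kind_def cpoly_def by simp
  also have "\<dots> = w k - poly (E k) z * (\<integral>t. 1 / (complex_of_real t - z) \<partial>M)"
    unfolding w_def Bochner_Integration.integral_diff[OF int' integrable_mult_right[OF int]]
    by (simp only: Bochner_Integration.integral_mult_right_zero)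
  finally show ?thesis
    by (simp add: cpoly_def)
qed

lemma degree_S: "degree S < p"
  unfolding S_def using p_pos
  by (intro degree_sum_less) (auto simp: degree_E intro: le_less_trans[OF degree_smult_le])

lemma v_in_K: "v \<in> K"
  using L2_minus_coefficients_in_K[OF kernel_L2]
  by (simp add: v_def[abs_def] S_def w_def poly_sum)

text \<open>The subtracted \<open>S\<close> has degree less than \<open>p\<close>, so it does not
  affect the coefficient along \<open>E p\<close>.\<close>

lemma integral_v_E_top: "(\<integral>t. v t * poly (E p) (complex_of_real t) \<partial>M) = w p"
proof -
  have "(\<integral>t. poly S (complex_of_real t) * poly (E p) (complex_of_real t) \<partial>M) = 0"
    using K_orthogonal[OF E_top_in_K degree_S] by (simp add: mult.commute)
  moreover have "(\<integral>t. v t * poly (E p) (complex_of_real t) \<partial>M) =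
    w p - (\<integral>t. poly S (complex_of_real t) * poly (E p) (complex_of_real t) \<partial>M)"
    unfolding v_def left_diff_distrib w_def using degree_S
    by (intro Bochner_Integration.integral_diff L2_mult_integrable kernel_L2 E_L2 poly_L2) auto
  ultimately show ?thesis
    by simp
qed

text \<open>\<open>R = (t - z) v\<close> is a polynomial of degree at most \<open>p\<close>; because \<open>v\<close> is orthogonal to the
  polynomials of degree less than \<open>p\<close>, only the last two Fourier coefficients of \<open>R\<close> survive.
  At \<open>t = z\<close> this is the Wronskian identity for \<open>e\<^bsub>p-1\<^esub>\<close>, \<open>e\<^sub>p\<close> and \<open>w\<close>.\<close>

definition R :: "complex poly" where
  "R = 1 - [:- z, 1:] * S"

lemma shifted_v: "(complex_of_real t - z) * v t = poly R (complex_of_real t)"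
  using minus_z_neq_0[of t] by (simp add: v_def R_def field_simps)

lemma R_eq: "R = Polynomial.smult (of_real \<beta> * w p) (E (p - 1)) - Polynomial.smult (of_real \<beta> * w (p - 1)) (E p)"
proof -
  define r where "r k = (\<integral>t. poly R (complex_of_real t) * poly (E k) (complex_of_real t) \<partial>M)" for k
  obtain m where m: "p = Suc m"
    using p_pos by (cases p) auto
  have "degree ([:- z, 1:] * S) \<le> p"
    using degree_mult_le[of "[:- z, 1:]" S] degree_S by simp
  then have "degree R \<le> p"
    unfolding R_def by (intro degree_diff_le) auto
  then have R: "R = (\<Sum>k\<le>p. Polynomial.smult (r k) (E k))"
    unfolding r_def by (rule E_expansion)
  \<comment> \<open>The factor \<open>t - z\<close> is moved from \<open>v\<close> to the basis
    polynomial.\<close>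
  have r: "r k = (\<integral>t. v t * poly ([:- z, 1:] * E k) (complex_of_real t) \<partial>M)" for k
    by (simp add: r_def shifted_v[symmetric] algebra_simps)
  have "r k = 0" if "k < m" for k
  proof -
    have "degree ([:- z, 1:] * E k) < p"
      using degree_mult_le[of "[:- z, 1:]" "E k"] degree_E[of k] that m by simp
    then show ?thesis
      unfolding r by (rule K_orthogonal[OF v_in_K])
  qed
  then have "(\<Sum>k<m. Polynomial.smult (r k) (E k)) = 0"
    by (intro sum.neutral) simp
  then have R2: "R = Polynomial.smult (r m) (E m) + Polynomial.smult (r p) (E p)"
    by (subst R) (simp add: m lessThan_Suc_atMost[symmetric])
  have "r m = of_real \<beta> * w p"
  proof -
    \<comment> \<open>This is \<open>(t - z) * E m\<close> with its component along
      \<open>E p\<close> removed. Its degree is less than \<open>p\<close>, so \<open>v\<close> does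
      not see it and only the removed part contributes.\<close>
    define q where "q = pCons 0 (E m) - Polynomial.smult (of_real \<beta>) (E p) - Polynomial.smult z (E m)"
    have pred: "p - 1 = m"
      using m by simp
    have "degree (Polynomial.smult z (E m)) < p"
      using m degree_E[of m] by (intro le_less_trans[OF degree_smult_le]) simp
    then have "degree q < p"
      unfolding q_def by (rule degree_diff_less[OF recurrence_top(1)[unfolded pred]])
    then have "(\<integral>t. v t * poly q (complex_of_real t) \<partial>M) = 0"
      by (rule K_orthogonal[OF v_in_K])
    moreover have "r m = (\<integral>t. v t * poly q (complex_of_real t) + of_real \<beta> * (v t * poly (E p) (complex_of_real t)) \<partial>M)"
      unfolding r by (simp add: q_def algebra_simps)
    moreover have "\<dots> = (\<integral>t. v t * poly q (complex_of_real t) \<partial>M) + of_real \<beta> * w p"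
      unfolding integral_v_E_top[symmetric] using \<open>degree q < p\<close>
      by (subst Bochner_Integration.integral_add)
        (auto intro!: integrable_mult_poly K_L2[OF v_in_K] simp: degree_E)
    ultimately show ?thesis
      by simp
  qed
  \<comment> \<open>Here \<open>(t - z) * E p\<close> has degree \<open>p + 1\<close>, outside the
    reach of orthogonality to \<open>v\<close>, so the coefficients of degree \<open>p\<close> in
    \<open>R\<close> are compared instead.\<close>
  moreover have "r p = - of_real \<beta> * w m"
  proof -
    have "coeff S m = w m * coeff (E m) m"
    proof -
      have "(\<Sum>j<m. w j * coeff (E j) m) = 0"
        using m by (intro sum.neutral) (auto simp: coeff_eq_0 degree_E)
      then show ?thesis
        unfolding S_def coeff_sum by (simp add: m)
    qed
    moreover have "coeff S p = 0"
      using degree_S by (rule coeff_eq_0)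
    ultimately have "coeff R p = - w m * coeff (E m) m"
      unfolding R_def by (simp add: m)
    moreover have "coeff (E m) p = 0"
      using m by (intro coeff_eq_0) (simp add: degree_E)
    then have "coeff R p = r p * coeff (E p) p"
      by (simp add: R2)
    moreover have "coeff (E m) m = of_real \<beta> * coeff (E p) p"
      using recurrence_top(2) first_kind_orthonormal(1)[of p] first_kind_orthonormal(1)[of m] m
      by (simp add: coeff_E)
    ultimately have "r p * coeff (E p) p = (- of_real \<beta> * w m) * coeff (E p) p"
      by simp
    then show ?thesis
      by (rule mult_right_cancel[OF lead_coeff_E_neq_0[OF order_refl], THEN iffD1])
  qed
  ultimately show ?thesis
    using R2 by (simp add: m)
qed

lemma wronskian: "of_real \<beta> * (w p * poly (E (p - 1)) z - w (p - 1) * poly (E p) z) = 1"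
proof -
  have "poly R z = 1"
    by (simp add: R_def)
  then show ?thesis
    by (simp add: R_eq algebra_simps)
qed

text \<open>Places \<open>v\<close> in the domain of multiplication by \<open>t\<close>: the product
  is \<open>R + z * v\<close>, and \<open>R\<close> has degree at most \<open>p\<close>.\<close>

lemma times_v_L2: "(\<lambda>t. complex_of_real t * v t) \<in> L2 M"
proof -
  have "(\<lambda>t. poly R (complex_of_real t) + z * v t) \<in> L2 M"
    unfolding R_eq using degree_E
    by (intro L2_add L2_cmult K_L2[OF v_in_K] poly_L2 degree_diff_le order_trans[OF degree_smult_le]) auto
  then show ?thesis
    by (simp add: shifted_v[symmetric] algebra_simps)
qed

text \<open>Otherwise \<open>(t - z) v\<close> would be orthogonal to \<open>v\<close>, hence \<open>v = 0\<close>.\<close>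

lemma w_pred_neq_0: "w (p - 1) \<noteq> 0"
proof
  assume 0: "w (p - 1) = 0"
  have "degree R < p"
    unfolding R_eq 0 using degree_E[of "p - 1"] p_pos
    by (simp add: le_less_trans[OF degree_smult_le])
  then have "L2_inner M (\<lambda>t. poly R (complex_of_real t)) v = 0"
    using v_in_K by (rule poly_orthogonal_K)
  then have "AE t in M. v t = 0"
    by (intro AE_eq_0_if_shifted_form_eq_0[OF _ times_v_L2 z] K_L2[OF v_in_K])
      (simp add: L2_inner_def shifted_v)
  \<comment> \<open>If \<open>v\<close> vanishes, then so does \<open>w p\<close>, and both terms of
    the Wronskian identity are zero.\<close>
  then have "w p = (\<integral>t. 0 \<partial>M)"
    unfolding integral_v_E_top[symmetric] using K_L2[OF v_in_K] E_L2[of p]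
    by (intro integral_cong_AE) (auto simp: L2_def)
  then show False
    using wronskian 0 by simp
qed

text \<open>The kernel \<open>1 / (t - z)\<close> shows that the choice in \<open>resolvent\<close>
  is not vacuous, and every solution agrees with it almost everywhere.\<close>

lemma resolvent_mult_op:
  "L2_inner M (resolvent M (mult_op M) z (\<lambda>_. 1)) (\<lambda>_. 1) = (\<integral>t. 1 / (complex_of_real t - z) \<partial>M)"
proof -
  define x where "x = resolvent M (mult_op M) z (\<lambda>_. 1)"
  let ?k = "\<lambda>t. 1 / (complex_of_real t - z)"
  have tk: "complex_of_real t * ?k t = 1 + z * ?k t" for t
    using minus_z_neq_0[of t] by (simp add: field_simps)
  have "(\<lambda>t. 1 + z * ?k t) \<in> L2 M"
    using L2_add[OF poly_L2[of 1] L2_cmult[OF kernel_L2, of z]] by simp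
  then have "?k \<in> fst (mult_op M) \<and> (AE t in M. snd (mult_op M) ?k t - z * ?k t = 1)"
    unfolding mult_op_def fst_conv snd_conv tk using kernel_L2 by (simp add: tk del: times_divide_eq_right)
  then have "\<exists>x. x \<in> fst (mult_op M) \<and> (AE t in M. snd (mult_op M) x t - z * x t = 1)"
    by (intro exI[of _ ?k])
  then have "x \<in> fst (mult_op M) \<and> (AE t in M. snd (mult_op M) x t - z * x t = 1)"
    unfolding x_def resolvent_def by (rule someI_ex)
  then have x: "x \<in> L2 M" and "AE t in M. complex_of_real t * x t - z * x t = 1"
    by (auto simp: mult_op_def)
  from this(2) have "AE t in M. x t = ?k t"
  proof eventually_elim
    case (elim t)
    then show ?case
      using minus_z_neq_0[of t] by (simp add: field_simps)
  qed
  then show ?thesis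
    unfolding L2_inner_def x_def[symmetric] using x kernel_L2
    by (intro integral_cong_AE) (auto simp: L2_def)
qed

text \<open>Dividing \<open>R\<close> by \<open>- w (p - 1)\<close> makes its component along
  \<open>E p\<close> equal to the required right-hand side. The remaining component along
  \<open>E (p - 1)\<close> disappears under the projection onto \<open>K\<close>.\<close>

lemma compression_resolvent_exists:
  "\<exists>x. x \<in> fst (compression M K (mult_op M)) \<and>
    (AE t in M. snd (compression M K (mult_op M)) x t - z * x t = of_real \<beta> * poly (E p) (complex_of_real t))"
proof -
  define x where "x = (\<lambda>t. (- 1 / w (p - 1)) * v t)"
  \<comment> \<open>The value that the resolvent equation prescribes for the projection of
    \<open>t * x\<close>.\<close>
  define g where "g = (\<lambda>t. z * x t + of_real \<beta> * poly (E p) (complex_of_real t))"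
  define a where "a = - (of_real \<beta> * w p / w (p - 1))"
  have x: "x \<in> K"
    unfolding x_def by (intro K_cmult v_in_K)
  have tx: "(\<lambda>t. complex_of_real t * x t) \<in> L2 M"
    using L2_cmult[OF times_v_L2, of "- 1 / w (p - 1)"] by (simp add: x_def mult_ac)
  have diff: "complex_of_real t * x t - g t = poly (Polynomial.smult a (E (p - 1))) (complex_of_real t)" for t
  proof -
    have "(complex_of_real t - z) * x t = - 1 / w (p - 1) * poly R (complex_of_real t)"
      unfolding x_def shifted_v[symmetric] by (simp add: mult_ac)
    also have "\<dots> = a * poly (E (p - 1)) (complex_of_real t) + of_real \<beta> * poly (E p) (complex_of_real t)"
      using w_pred_neq_0 by (simp add: R_eq a_def field_simps)
    finally show ?thesis
      by (simp add: g_def algebra_simps)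
  qed
  have "degree (Polynomial.smult a (E (p - 1))) < p"
    using degree_E[of "p - 1"] p_pos by (intro le_less_trans[OF degree_smult_le]) simp
  then have "L2_inner M (\<lambda>t. complex_of_real t * x t - g t) h = 0" if "h \<in> K" for h
    unfolding diff using that by (rule poly_orthogonal_K)
  moreover have "g \<in> K"
    unfolding g_def by (intro K_add K_cmult x E_top_in_K)
  ultimately have "AE t in M. L2_proj M K (\<lambda>t. complex_of_real t * x t) t = g t"
    by (intro L2_proj_K_unique tx)
  then have "AE t in M. snd (compression M K (mult_op M)) x t - z * x t = of_real \<beta> * poly (E p) (complex_of_real t)"
    by eventually_elim (simp add: compression_def mult_op_def g_def)
  moreover have "x \<in> fst (compression M K (mult_op M))"
    using x tx K_L2[OF x] by (simp add: compression_def mult_op_def)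
  ultimately show ?thesis
    by blast
qed

text \<open>Testing \<open>D x - z x = u\<^sub>p\<close> against \<open>cnj v\<close> gives \<open>n\<^sub>p\<close> without solving for \<open>x\<close>.\<close>

lemma resolvent_compression:
  fixes u\<^sub>p :: l2_vec
  defines "u\<^sub>p \<equiv> \<lambda>t. of_real \<beta> * poly (E p) (complex_of_real t)"
  shows "L2_inner M (resolvent M (compression M K (mult_op M)) z u\<^sub>p) u\<^sub>p = - (of_real \<beta> * w p / w (p - 1))"
proof -
  define D where "D = compression M K (mult_op M)"
  define x where "x = resolvent M D z u\<^sub>p"
  define g where "g = L2_proj M K (\<lambda>t. complex_of_real t * x t)"
  have "x \<in> fst D \<and> (AE t in M. snd D x t - z * x t = u\<^sub>p t)"
    unfolding x_def resolvent_def D_def u\<^sub>p_def using compression_resolvent_exists by (rule someI_ex)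
  then have x: "x \<in> K" and tx: "(\<lambda>t. complex_of_real t * x t) \<in> L2 M"
    and AE: "AE t in M. g t - z * x t = u\<^sub>p t"
    by (auto simp: D_def compression_def mult_op_def g_def)
  have g: "g \<in> K" and orth: "\<And>h. h \<in> K \<Longrightarrow> L2_inner M (\<lambda>t. complex_of_real t * x t - g t) h = 0"
    unfolding g_def using L2_proj_K[OF tx] by auto
  have up: "u\<^sub>p \<in> K"
    unfolding u\<^sub>p_def by (intro K_cmult E_top_in_K)
  have int: "integrable M (\<lambda>t. x t * poly (E k) (complex_of_real t))" if "k \<le> p" for k
    using that by (intro integrable_mult_poly K_L2 x) (simp add: degree_E)
  have [measurable]: "x \<in> borel_measurable M" "g \<in> borel_measurable M" "v \<in> borel_measurable M"
    "u\<^sub>p \<in> borel_measurable M"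
    using K_L2[OF x] K_L2[OF g] K_L2[OF v_in_K] K_L2[OF up] by (auto simp: L2_def)
  have [measurable]: "(\<lambda>t. poly R (complex_of_real t)) \<in> borel_measurable M"
    unfolding shifted_v[symmetric] by measurable
  have "0 = (\<integral>t. (complex_of_real t * x t - g t) * v t \<partial>M)"
    using orth[OF K_cnj[OF v_in_K]] by (simp add: L2_inner_def)
  \<comment> \<open>Adding and subtracting \<open>z * x\<close> moves \<open>t - z\<close> onto
    \<open>v\<close>, where it produces \<open>R\<close>, and leaves the residual
    \<open>g - z * x\<close>, which is the right-hand side of the equation.\<close>
  also have "\<dots> = (\<integral>t. x t * poly R (complex_of_real t) - u\<^sub>p t * v t \<partial>M)"
  proof (rule integral_cong_AE)
    show "AE t in M. (complex_of_real t * x t - g t) * v t = x t * poly R (complex_of_real t) - u\<^sub>p t * v t"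
      using AE
    proof eventually_elim
      case (elim t)
      have "(complex_of_real t * x t - g t) * v t = x t * ((complex_of_real t - z) * v t) - (g t - z * x t) * v t"
        by (simp add: algebra_simps)
      then show ?case
        by (simp only: elim shifted_v)
    qed
  qed measurable
  also have "\<dots> = (\<integral>t. of_real \<beta> * w p * (x t * poly (E (p - 1)) (complex_of_real t))
      - of_real \<beta> * w (p - 1) * (x t * poly (E p) (complex_of_real t))
      - of_real \<beta> * (v t * poly (E p) (complex_of_real t)) \<partial>M)"
    by (simp add: R_eq u\<^sub>p_def algebra_simps)
  also have "\<dots> = of_real \<beta> * w p * (\<integral>t. x t * poly (E (p - 1)) (complex_of_real t) \<partial>M)
      - of_real \<beta> * w (p - 1) * (\<integral>t. x t * poly (E p) (complex_of_real t) \<partial>M) - of_real \<beta> * w p"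
    unfolding integral_v_E_top[symmetric] using int[of p] int[of "p - 1"] integrable_mult_poly[OF K_L2[OF v_in_K], of "E p"]
    by (simp add: degree_E)
  also have "(\<integral>t. x t * poly (E (p - 1)) (complex_of_real t) \<partial>M) = 0"
    using p_pos by (intro K_orthogonal[OF x]) (simp add: degree_E)
  finally have "of_real \<beta> * (w (p - 1) * (\<integral>t. x t * poly (E p) (complex_of_real t) \<partial>M) + w p) = 0"
    by (simp add: ring_distribs mult.assoc neg_eq_iff_add_eq_0)
  then have "w (p - 1) * (\<integral>t. x t * poly (E p) (complex_of_real t) \<partial>M) + w p = 0"
    using \<beta>_pos by simp
  then have "w (p - 1) * (\<integral>t. x t * poly (E p) (complex_of_real t) \<partial>M) = - w p"
    by (simp only: eq_neg_iff_add_eq_0)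
  then have "(\<integral>t. x t * poly (E p) (complex_of_real t) \<partial>M) = - w p / w (p - 1)"
    using w_pred_neq_0 by (simp add: field_simps)
  \<comment> \<open>The conjugation has no effect because \<open>\<beta>\<close> and the values of
    \<open>E p\<close> on the real axis are real.\<close>
  moreover have "L2_inner M x u\<^sub>p = of_real \<beta> * (\<integral>t. x t * poly (E p) (complex_of_real t) \<partial>M)"
    by (simp add: L2_inner_def u\<^sub>p_def poly_map_of_real mult.left_commute[of _ "of_real \<beta>"])
  ultimately show ?thesis
    by (simp add: x_def D_def)
qed

end

end

section \<open>The fractional linear formula for \<open>n\<close>\<close>

theorem theorem6p1:
  fixes p :: nat
    and n :: "complex \<Rightarrow> complex"
    and s :: "nat \<Rightarrow> real"
    and \<sigma> :: "real measure"
    and A D :: l2_op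
    and H' :: "l2_vec set"
    and u u\<^sub>p :: l2_vec
    and e :: "nat \<Rightarrow> real poly"
    and d :: "nat \<Rightarrow> complex \<Rightarrow> complex"
    and b :: complex
    and n\<^sub>p :: "complex \<Rightarrow> complex"
  assumes "p \<ge> 1"
    and "nevanlinna n"
    and "property1 p n s \<or> property2 p n s \<or> property3 p n s"
    and "hankel_det p s \<noteq> 0"
    and "finite_measure \<sigma>" and "sets \<sigma> = sets borel"
    and "\<And>z. z \<notin> \<real> \<Longrightarrow> n z = (\<integral>t. 1 / (complex_of_real t - z) \<partial>\<sigma>)"
    and "A = mult_op \<sigma>"
    and "u = (\<lambda>_. 1)"
    and "e = first_kind \<sigma>"
    and "d = second_kind \<sigma>"
    and "b = L2_inner \<sigma> (snd A (poly_vec (e (p - 1)))) (poly_vec (e p))"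
    and "H' = L2_ominus \<sigma> (monomial_span p)"
    and "D = compression \<sigma> H' A"
    and "u\<^sub>p = (\<lambda>t. b * poly_vec (e p) t)"
    and "\<And>z. z \<notin> \<real> \<Longrightarrow> n\<^sub>p z = L2_inner \<sigma> (resolvent \<sigma> D z u\<^sub>p) u\<^sub>p"
  shows "b \<in> \<real> \<and> Re b > 0 \<and> u\<^sub>p \<in> H' \<and>
    (\<forall>z. z \<notin> \<real> \<longrightarrow>
       n z = L2_inner \<sigma> (resolvent \<sigma> A z u) u \<and>
       cpoly (e (p - 1)) z * n\<^sub>p z + b * cpoly (e p) z \<noteq> 0 \<and>
       n z = - ((d (p - 1) z * n\<^sub>p z + b * d p z)
                / (cpoly (e (p - 1)) z * n\<^sub>p z + b * cpoly (e p) z)))"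
proof -
  note mom = moments[OF assms(5,6,7) property_imp_truncated_expansion[OF assms(3)] order_refl]
  have int: "integrable \<sigma> (\<lambda>t. t ^ i)" if "i \<le> 2 * p" for i
    using integrable_power[OF assms(5,6) conjunct1[OF mom] that] .
  have s: "s i = (\<integral>t. t ^ i \<partial>\<sigma>)" if "i \<le> 2 * p" for i
    using mom that by blast
  interpret finite_measure \<sigma> by fact
  interpret moment_space \<sigma> p
    using assms(1,6) int hankel_nondegenerate[OF int s assms(4)] by unfold_locales auto
  have b: "b = of_real \<beta>"
    unfolding assms(8,10,12)
    by (simp add: L2_inner_def mult_op_def poly_vec_def \<beta>_def flip: of_real_mult)
  have up: "u\<^sub>p = (\<lambda>t. of_real \<beta> * poly (E p) (complex_of_real t))"
    unfolding assms(15) b assms(10) by (simp add: poly_vec_def poly_map_of_real)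
  have "n z = L2_inner \<sigma> (resolvent \<sigma> A z u) u \<and>
       cpoly (e (p - 1)) z * n\<^sub>p z + b * cpoly (e p) z \<noteq> 0 \<and>
       n z = - ((d (p - 1) z * n\<^sub>p z + b * d p z)
                / (cpoly (e (p - 1)) z * n\<^sub>p z + b * cpoly (e p) z))" if z: "z \<notin> \<real>" for z
  proof (intro conjI)
    let ?w = "w z"
    let ?e = "\<lambda>k. cpoly (e k) z"
    show "n z = L2_inner \<sigma> (resolvent \<sigma> A z u) u"
      unfolding assms(7)[OF z] assms(8,9) resolvent_mult_op[OF z] ..
    have np: "n\<^sub>p z = - (b * ?w p / ?w (p - 1))"
      unfolding assms(16)[OF z] assms(14,13,8) up b by (rule resolvent_compression[OF z])
    have w: "?w k = ?e k * n z + d k z" if "k \<le> p" for k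
      unfolding assms(7)[OF z] assms(10,11) using w_eq[OF z that] .
    have w0: "?w (p - 1) \<noteq> 0"
      by (rule w_pred_neq_0[OF z])
    have "b * (?w p * ?e (p - 1) - ?w (p - 1) * ?e p) = 1"
      using wronskian[OF z] by (simp add: b assms(10) cpoly_def)
    then have den: "?e (p - 1) * n\<^sub>p z + b * ?e p = - 1 / ?w (p - 1)"
      using w0 unfolding np by (simp add: field_simps)
    then show den0: "?e (p - 1) * n\<^sub>p z + b * ?e p \<noteq> 0"
      using w0 by simp
    \<comment> \<open>Inserting \<open>?w k = ?e k * n z + d k z\<close> makes this relation linear
      in \<open>n z\<close>.\<close>
    have "n\<^sub>p z * ?w (p - 1) + b * ?w p = 0"
      unfolding np using w0 by simp
    then have "n z * (?e (p - 1) * n\<^sub>p z + b * ?e p) = - (d (p - 1) z * n\<^sub>p z + b * d p z)"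
      using w[of p] w[of "p - 1"] by (simp add: eq_neg_iff_add_eq_0 algebra_simps)
    then show "n z = - ((d (p - 1) z * n\<^sub>p z + b * d p z) / (?e (p - 1) * n\<^sub>p z + b * ?e p))"
      unfolding minus_divide_left nonzero_eq_divide_eq[OF den0] .
  qed
  moreover have "b \<in> \<real>" "Re b > 0"
    using \<beta>_pos by (auto simp: b)
  moreover have "u\<^sub>p \<in> H'"
    unfolding up assms(13) by (intro K_cmult E_top_in_K)
  ultimately show ?thesis
    by blast
qed

end
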